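(* Let $m,n\in\mathbf N$, $\alpha,\beta>0$, $\sigma>1$, $p>1$, $\frac1p+\frac1q=1$, and put $\Phi(x):=\|x\|_\alpha^{p(m-\sigma)-m}$ $(x\in\mathbf R_+^m)$, $\Psi(y):=\|y\|_\beta^{q(n+\sigma)-n}$ $(y\in\mathbf R_+^n)$. Then the operator $T:L_{p,\Phi}(\mathbf R_+^m)\to L_{p,\Psi^{1-p}}(\mathbf R_+^n)$ defined by $$(Tf)(y):=\int_{\mathbf R_+^m}\left(\coth\frac{\|x\|_\alpha}{\|y\|_\beta}-1\right)f(x)\,dx\qquad(y\in\mathbf R_+^n)$$ is bounded, and its norm $$\|T\|:=\sup_{f(\ne0)\in L_{p,\Phi}(\mathbf R_+^m)}\frac{\|Tf\|_{p,\Psi^{1-p}}}{\|f\|_{p,\Phi}}$$ equals $$\|T\|=\left[\frac{\Gamma^n(\frac1\beta)}{\beta^{n-1}\Gamma(\frac n\beta)}\right]^{\frac1p}\left[\frac{\Gamma^m(\frac1\alpha)}{\alpha^{m-1}\Gamma(\frac m\alpha)}\right]^{\frac1q}\frac{\Gamma(\sigma)}{2^{\sigma-1}}\zeta(\sigma).$$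
   Context: $\mathbf N$ is the set of positive integers, $\mathbf R_+=(0,\infty)$. For $x\in\mathbf R^m$, $\|x\|_\alpha:=\left(\sum_{k=1}^m|x_k|^\alpha\right)^{1/\alpha}$; for $y\in\mathbf R^n$, $\|y\|_\beta:=\left(\sum_{k=1}^n|y_k|^\beta\right)^{1/\beta}$. For a positive weight $w$ on $\mathbf R_+^s$, $L_{p,w}(\mathbf R_+^s)$ is the space of measurable functions $h$ with $\|h\|_{p,w}:=\left\{\int_{\mathbf R_+^s}w(z)|h(z)|^p\,dz\right\}^{1/p}<\infty$ (modulo a.e. equality). Here $\Psi^{1-p}(y)=(\Psi(y))^{1-p}=\|y\|_\beta^{-p\sigma-n}$. $\coth u=\frac{e^u+e^{-u}}{e^u-e^{-u}}$; $\Gamma$ is the Gamma function and $\zeta(\sigma)=\sum_{k\ge1}k^{-\sigma}$ the Riemann zeta function. *)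

theory Defs
  imports "HOL-Analysis.Analysis"
begin

text \<open>
  Euclidean space of dimension m is the type \<open>real ^ 'm\<close> with \<open>CARD('m) = m\<close>.
\<close>

definition orthant :: "(real ^ 's) set" where
  "orthant = {x. \<forall>i. 0 < x $ i}"

text \<open>For \<open>a < 1\<close> this is only a quasi-norm.\<close>

definition pnorm :: "real \<Rightarrow> real ^ 's \<Rightarrow> real" where
  "pnorm a x = (\<Sum>k\<in>UNIV. \<bar>x $ k\<bar> powr a) powr (1 / a)"

abbreviation orthant_measure :: "(real ^ 's) measure" where
  "orthant_measure \<equiv> lebesgue_on orthant"

text \<open>
  Weighted Lebesgue spaces are represented by functions rather than by classes modulo
  a.e. equality; values outside the orthant are irrelevant.
\<close>

definition wLp :: "real \<Rightarrow> (real ^ 's \<Rightarrow> real) \<Rightarrow> (real ^ 's \<Rightarrow> real) set" where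
  "wLp p w = {h. h \<in> borel_measurable orthant_measure \<and>
                 integrable orthant_measure (\<lambda>z. w z * \<bar>h z\<bar> powr p)}"

definition wLp_norm :: "real \<Rightarrow> (real ^ 's \<Rightarrow> real) \<Rightarrow> (real ^ 's \<Rightarrow> real) \<Rightarrow> real" where
  "wLp_norm p w h = (LINT z|orthant_measure. w z * \<bar>h z\<bar> powr p) powr (1 / p)"

text \<open>
  Bounded linear operators between the spaces of a.e. classes, in terms of representatives:
  \<open>T\<close> maps the first space into the second, respects a.e. equality, and is linear and bounded.
\<close>

definition bounded_wLp_operator ::
    "real \<Rightarrow> (real ^ 'm \<Rightarrow> real) \<Rightarrow> (real ^ 'n \<Rightarrow> real) \<Rightarrow>
      ((real ^ 'm \<Rightarrow> real) \<Rightarrow> (real ^ 'n \<Rightarrow> real)) \<Rightarrow> bool" where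
  "bounded_wLp_operator p w v T \<longleftrightarrow>
     (\<forall>f\<in>wLp p w. T f \<in> wLp p v) \<and>
     (\<forall>f\<in>wLp p w. \<forall>g\<in>wLp p w. (AE x in orthant_measure. f x = g x) \<longrightarrow>
        (AE y in orthant_measure. T f y = T g y)) \<and>
     (\<forall>f\<in>wLp p w. \<forall>g\<in>wLp p w.
        AE y in orthant_measure. T (\<lambda>x. f x + g x) y = T f y + T g y) \<and>
     (\<forall>c. \<forall>f\<in>wLp p w. AE y in orthant_measure. T (\<lambda>x. c * f x) y = c * T f y) \<and>
     (\<exists>C. \<forall>f\<in>wLp p w. wLp_norm p v (T f) \<le> C * wLp_norm p w f)"

text \<open>
  This is a supremum in \<open>real\<close>, hence meaningful only for bounded operators.
\<close>

definition wLp_opnorm ::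
    "real \<Rightarrow> (real ^ 'm \<Rightarrow> real) \<Rightarrow> (real ^ 'n \<Rightarrow> real) \<Rightarrow>
      ((real ^ 'm \<Rightarrow> real) \<Rightarrow> (real ^ 'n \<Rightarrow> real)) \<Rightarrow> real" where
  "wLp_opnorm p w v T =
     (SUP f\<in>{f \<in> wLp p w. \<not> (AE x in orthant_measure. f x = 0)}.
        wLp_norm p v (T f) / wLp_norm p w f)"

definition weight_Phi :: "real \<Rightarrow> real \<Rightarrow> real \<Rightarrow> real ^ 'm \<Rightarrow> real" where
  "weight_Phi \<alpha> \<sigma> p x =
     pnorm \<alpha> x powr (p * (real CARD('m) - \<sigma>) - real CARD('m))"

definition weight_Psi :: "real \<Rightarrow> real \<Rightarrow> real \<Rightarrow> real ^ 'n \<Rightarrow> real" where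
  "weight_Psi \<beta> \<sigma> q y =
     pnorm \<beta> y powr (q * (real CARD('n) + \<sigma>) - real CARD('n))"

definition coth :: "real \<Rightarrow> real" where
  "coth u = (exp u + exp (- u)) / (exp u - exp (- u))"

text \<open>The Riemann zeta function, for real arguments greater than 1.\<close>

definition zeta :: "real \<Rightarrow> real" where
  "zeta s = (\<Sum>k. real (Suc k) powr (- s))"

definition coth_kernel :: "real \<Rightarrow> real \<Rightarrow> real ^ 'm \<Rightarrow> real ^ 'n \<Rightarrow> real" where
  "coth_kernel \<alpha> \<beta> x y = coth (pnorm \<alpha> x / pnorm \<beta> y) - 1"

definition coth_operator ::
    "real \<Rightarrow> real \<Rightarrow> (real ^ 'm \<Rightarrow> real) \<Rightarrow> real ^ 'n \<Rightarrow> real" where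
  "coth_operator \<alpha> \<beta> f y =
     (LINT x|orthant_measure. coth_kernel \<alpha> \<beta> x y * f x)"

end

theory Submission
  imports Defs "HOL-Real_Asymp.Real_Asymp"
begin

text \<open>
  Write \<open>m\<close>, \<open>n\<close> for the two dimensions, \<open>|x|\<close> and \<open>|y|\<close> for the \<open>\<alpha>\<close>- and \<open>\<beta>\<close>-norms, and
  \<open>k(u) = coth u - 1\<close>. The kernel \<open>k(|x| / |y|)\<close> depends only on the quotient of the norms, so on radial
  functions \<open>f(x) = |x|^(\<sigma>-m) G(ln |x|)\<close> the operator is, in logarithmic coordinates and up to the
  factor \<open>|y|^\<sigma>\<close>, convolution of \<open>G\<close> on the real line with a positive function whose integral is
  that of \<open>k(exp t) exp (\<sigma> t)\<close>, and both weighted norms become \<open>L_p\<close> norms on the line. The norm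
  of such a convolution is the integral of the convolving function, and the surface constants of
  the two orthants account for the remaining factors.

  Two integrals are computed. Polar integration, \<open>nn_integral_polar\<close>, states that the integral of
  \<open>F(|x|)\<close> over the orthant is \<open>Gamma(1/\<alpha>)^m / (\<alpha>^(m-1) Gamma(m/\<alpha>))\<close> times the integral of
  \<open>F(exp t) exp (m t)\<close> over the line. The Mellin transform of the kernel,
  \<open>nn_integral_coth_minus_one\<close>, follows from \<open>coth u - 1 = 2 exp (-2u) + 2 exp (-4u) + \<dots>\<close>,
  integrated termwise: it equals \<open>\<kappa> = 2 Gamma(\<sigma>) zeta(\<sigma>) / 2^\<sigma>\<close>.

  The upper bound is the Schur test (\<open>coth_operator_pointwise\<close>, \<open>coth_operator_schur_bound\<close>): split
  \<open>f = (|x|^((m-\<sigma>)/q) f) |x|^((\<sigma>-m)/q)\<close>, apply the Hoelder inequality with respect to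
  \<open>k(|x| / |y|) dx\<close>, raise to the power \<open>p\<close>, integrate in \<open>y\<close> and exchange the integrals. Both inner
  integrals are then explicit powers by polar integration.

  The lower bound (\<open>coth_operator_test_function\<close>, \<open>coth_operator_lower_bound\<close>) uses
  \<open>f = |x|^(\<sigma>-m)\<close> restricted to \<open>1 \<le> |x| \<le> exp R\<close>. For \<open>exp L \<le> |y| \<le> exp (R - L)\<close> the value
  \<open>T f y\<close> is at least \<open>C |y|^\<sigma> \<kappa>_L\<close>, where \<open>C\<close> is the surface constant in the variable \<open>x\<close> and
  \<open>\<kappa>_L\<close> is the part of \<open>\<kappa>\<close> with \<open>|t| \<le> L\<close>. In logarithmic coordinates the two
  annuli have lengths \<open>R\<close> and \<open>R - 2 L\<close>, so the quotient of norms loses only the factor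
  \<open>((R - 2 L) / R)^(1/p)\<close> and the passage from \<open>\<kappa>\<close> to \<open>\<kappa>_L\<close>; let \<open>R\<close> and then \<open>L\<close> tend to
  infinity.
\<close>

section \<open>Integrals in logarithmic coordinates\<close>

lemma nn_integral_exp_substitution:
  fixes F :: "real \<Rightarrow> ennreal"
  assumes [measurable]: "F \<in> borel_measurable borel"
  shows "(\<integral>\<^sup>+r. F r * indicator {0<..} r \<partial>lborel) = (\<integral>\<^sup>+t. F (exp t) * ennreal (exp t) \<partial>lborel)"
proof -
  \<comment> \<open>Exhaust the half-line by the images of compact intervals, on which the substitution rule holds.\<close>
  define A where "A n = {- real (Suc n)..real (Suc n)}" for n
  define B where "B n = {exp (- real (Suc n))..exp (real (Suc n))}" for n
  have incA: "incseq A" and incB: "incseq B"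
    by (force simp: A_def B_def incseq_def intro: order_trans)+
  have UA: "(\<Union>n. A n) = UNIV"
  proof -
    have "\<exists>n. t \<in> A n" for t
    proof -
      obtain n where "\<bar>t\<bar> \<le> real n" using real_arch_simple by blast
      then show ?thesis by (intro exI[of _ n]) (auto simp: A_def)
    qed
    then show ?thesis by auto
  qed
  have UB: "(\<Union>n. B n) = {0<..}"
  proof -
    have "\<exists>n. r \<in> B n" if "0 < r" for r
    proof -
      from UA obtain n where "ln r \<in> A n" by blast
      then have "exp (- real (Suc n)) \<le> exp (ln r)" "exp (ln r) \<le> exp (real (Suc n))"
        unfolding exp_le_cancel_iff by (auto simp: A_def)
      with that show ?thesis by (auto simp: B_def)
    qed
    moreover have "0 < r" if "r \<in> B n" for r n
      using that exp_gt_zero[of "- real (Suc n)"] by (simp add: B_def del: exp_gt_zero)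
    ultimately show ?thesis by auto
  qed
  have sup: "(\<integral>\<^sup>+r. G r * indicator (\<Union>n. C n) r \<partial>lborel) = (SUP n. \<integral>\<^sup>+r. G r * indicator (C n) r \<partial>lborel)"
    if C: "incseq C" "\<And>n. C n \<in> sets borel" and G: "G \<in> borel_measurable borel"
    for C :: "nat \<Rightarrow> real set" and G :: "real \<Rightarrow> ennreal"
  proof -
    have "(SUP n. \<integral>\<^sup>+r. G r * indicator (C n) r \<partial>lborel) = (SUP n. emeasure (density lborel G) (C n))"
      using C G by (simp add: emeasure_density)
    also have "\<dots> = emeasure (density lborel G) (\<Union>n. C n)"
      using C by (intro SUP_emeasure_incseq) auto
    also have "\<dots> = (\<integral>\<^sup>+r. G r * indicator (\<Union>n. C n) r \<partial>lborel)"
      using C G by (intro emeasure_density) auto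
    finally show ?thesis by simp
  qed
  have "(\<integral>\<^sup>+r. F r * indicator {0<..} r \<partial>lborel) = (SUP n. \<integral>\<^sup>+r. F r * indicator (B n) r \<partial>lborel)"
    unfolding UB[symmetric] by (rule sup[OF incB]) (auto simp: B_def)
  also have "\<dots> = (SUP n. \<integral>\<^sup>+t. F (exp t) * ennreal (exp t) * indicator (A n) t \<partial>lborel)"
    unfolding A_def B_def
    by (intro SUP_cong refl nn_integral_substitution_aux)
       (auto intro!: derivative_eq_intros continuous_intros)
  also have "\<dots> = (\<integral>\<^sup>+t. F (exp t) * ennreal (exp t) * indicator (\<Union>n. A n) t \<partial>lborel)"
    by (rule sup[OF incA, symmetric]) (auto simp: A_def)
  finally show ?thesis by (simp add: UA)
qed

lemma nn_integral_lborel_translate: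
  fixes F :: "real \<Rightarrow> ennreal"
  assumes "F \<in> borel_measurable borel"
  shows "(\<integral>\<^sup>+t. F (t + c) \<partial>lborel) = (\<integral>\<^sup>+t. F t \<partial>lborel)"
  using nn_integral_real_affine[OF assms, of 1 c] by (simp add: add.commute)

lemma nn_integral_lborel_uminus:
  fixes F :: "real \<Rightarrow> ennreal"
  assumes "F \<in> borel_measurable borel"
  shows "(\<integral>\<^sup>+t. F (- t) \<partial>lborel) = (\<integral>\<^sup>+t. F t \<partial>lborel)"
  using nn_integral_real_affine[OF assms, of "-1" 0] by simp

lemma nn_integral_Gamma_log:
  assumes "b > 0"
  shows "(\<integral>\<^sup>+t. ennreal (exp (b * t) * exp (- exp t)) \<partial>lborel) = ennreal (Gamma b)"
proof -
  have "ennreal (Gamma b) = (\<integral>\<^sup>+r. ennreal (indicator {0..} r * r powr (b - 1) / exp r) \<partial>lborel)"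
    by (rule Gamma_conv_nn_integral_real[OF assms])
  also have "\<dots> = (\<integral>\<^sup>+r. ennreal (r powr (b - 1) * exp (- r)) * indicator {0<..} r \<partial>lborel)"
    by (intro nn_integral_cong) (auto simp: indicator_def exp_minus field_simps)
  also have "\<dots> = (\<integral>\<^sup>+t. ennreal (exp t powr (b - 1) * exp (- exp t)) * ennreal (exp t) \<partial>lborel)"
    by (rule nn_integral_exp_substitution) measurable
  also have "\<dots> = (\<integral>\<^sup>+t. ennreal (exp (b * t) * exp (- exp t)) \<partial>lborel)"
    by (intro nn_integral_cong)
       (simp add: ennreal_mult[symmetric] powr_def exp_add[symmetric] algebra_simps)
  finally show ?thesis by simp
qed

lemma nn_integral_Gamma_log_power:
  assumes "a > 0" "b > 0"
  shows "(\<integral>\<^sup>+t. ennreal (exp (b * t) * exp (- exp (a * t))) \<partial>lborel) = ennreal (Gamma (b / a) / a)"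
proof -
  have "ennreal (Gamma (b / a)) = (\<integral>\<^sup>+t. ennreal (exp (b / a * t) * exp (- exp t)) \<partial>lborel)"
    using assms by (intro nn_integral_Gamma_log[symmetric]) simp
  also have "\<dots> = ennreal a * (\<integral>\<^sup>+t. ennreal (exp (b * t) * exp (- exp (a * t))) \<partial>lborel)"
    using assms by (subst nn_integral_real_affine[where c=a and t=0]) auto
  finally have *: "ennreal (1 / a) * ennreal (Gamma (b / a)) =
      ennreal (1 / a) * (ennreal a * (\<integral>\<^sup>+t. ennreal (exp (b * t) * exp (- exp (a * t))) \<partial>lborel))"
    by simp
  show ?thesis
    using * assms by (simp add: mult.assoc[symmetric] ennreal_mult[symmetric] Gamma_real_nonneg)
qed

section \<open>Polar integration over the orthant\<close>

lemma open_orthant: "open (orthant :: (real ^ 'm) set)"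
proof -
  have "(orthant :: (real ^ 'm) set) = (\<Inter>i. {x. 0 < x $ i})"
    by (auto simp: orthant_def)
  moreover have "open {x :: real ^ 'm. 0 < x $ i}" for i
    by (intro open_Collect_less continuous_intros)
  ultimately show ?thesis by (metis (no_types, lifting) open_INT finite)
qed

lemma orthant_borel [measurable]: "(orthant :: (real ^ 'm) set) \<in> sets borel"
  by (rule borel_open[OF open_orthant])

lemma pnorm_borel [measurable]: "pnorm a \<in> borel_measurable (borel :: (real ^ 'm) measure)"
  unfolding pnorm_def by measurable

lemma pnorm_pos:
  assumes "x \<in> orthant"
  shows "pnorm a x > 0"
proof -
  have "(\<Sum>k\<in>UNIV. \<bar>x $ k\<bar> powr a) > 0"
    using assms by (intro sum_pos) (auto simp: orthant_def less_imp_neq[symmetric])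
  then show ?thesis unfolding pnorm_def by auto
qed

lemma pnorm_scale:
  assumes "c > 0" "a > 0"
  shows "pnorm a (c *\<^sub>R x) = c * pnorm a x"
  using assms
  by (simp add: pnorm_def abs_mult powr_mult sum_distrib_left[symmetric] sum_nonneg powr_powr)

lemma pnorm_powr:
  assumes "a > 0"
  shows "pnorm a x powr a = (\<Sum>k\<in>UNIV. \<bar>x $ k\<bar> powr a)"
  using assms by (simp add: pnorm_def powr_powr sum_nonneg)

lemma orthant_scale:
  assumes "c > 0"
  shows "c *\<^sub>R x \<in> orthant \<longleftrightarrow> x \<in> orthant"
  using assms by (simp add: orthant_def zero_less_mult_iff)

lemma nn_integral_lborel_scale:
  fixes F :: "real ^ 'm \<Rightarrow> ennreal"
  assumes [measurable]: "F \<in> borel_measurable borel" and "c > 0"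
  shows "ennreal (c ^ CARD('m)) * (\<integral>\<^sup>+x. F (c *\<^sub>R x) \<partial>lborel) = (\<integral>\<^sup>+x. F x \<partial>lborel)"
proof -
  have "(\<integral>\<^sup>+x. F x \<partial>lborel) =
        (\<integral>\<^sup>+x. F x \<partial>density (distr lborel borel (\<lambda>x. 0 + c *\<^sub>R x)) (\<lambda>_. \<bar>c\<bar> ^ DIM(real ^ 'm)))"
    using assms by (subst lborel_affine[of c 0]) auto
  also have "\<dots> = ennreal (c ^ CARD('m)) * (\<integral>\<^sup>+x. F (c *\<^sub>R x) \<partial>lborel)"
    using assms by (simp add: nn_integral_density nn_integral_distr nn_integral_cmult)
  finally show ?thesis ..
qed

lemma indicator_orthant_prod:
  "(indicator orthant (x :: real ^ 'm) :: real) = (\<Prod>i\<in>UNIV. indicator {0<..} (x $ i))"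
  by (auto simp: orthant_def indicator_def prod_zero_iff)

lemma prod_Basis_vec:
  fixes g :: "real \<Rightarrow> 'a :: comm_monoid_mult" and x :: "real ^ 'm"
  shows "(\<Prod>b\<in>Basis. g (x \<bullet> b)) = (\<Prod>i\<in>UNIV. g (x $ i))"
proof -
  have basis: "(Basis :: (real ^ 'm) set) = (\<lambda>i. axis i 1) ` UNIV"
    by (auto simp: Basis_vec_def)
  have "(\<Prod>b\<in>Basis. g (x \<bullet> b)) = (\<Prod>i\<in>UNIV. g (x \<bullet> axis i 1))"
    unfolding basis by (subst prod.reindex) (auto simp: inj_on_def axis_eq_axis)
  then show ?thesis by (simp add: inner_axis)
qed

text \<open>The integrand is a product of functions of one coordinate each.\<close>
lemma nn_integral_orthant_exp_pnorm:
  assumes "a > 0"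
  shows "(\<integral>\<^sup>+x. ennreal (exp (- (pnorm a x powr a))) * indicator (orthant :: (real ^ 'm) set) x \<partial>lborel)
     = ennreal ((Gamma (1 / a) / a) ^ CARD('m))"
proof -
  define g where "g r = exp (- (r powr a)) * indicator {0<..} r" for r :: real
  have [measurable]: "g \<in> borel_measurable borel" unfolding g_def by measurable
  have "(\<integral>\<^sup>+x. ennreal (exp (- (pnorm a x powr a))) * indicator (orthant :: (real ^ 'm) set) x \<partial>lborel)
      = (\<integral>\<^sup>+x. ennreal (\<Prod>b\<in>Basis. g (x \<bullet> b)) \<partial>(lborel :: (real ^ 'm) measure))"
  proof (intro nn_integral_cong)
    fix x :: "real ^ 'm"
    have "(\<Prod>b\<in>Basis. g (x \<bullet> b)) = (\<Prod>i\<in>UNIV. g (x $ i))" by (rule prod_Basis_vec)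
    also have "\<dots> = (\<Prod>i\<in>UNIV. exp (- (x $ i powr a))) * indicator orthant x"
      unfolding g_def indicator_orthant_prod by (rule prod.distrib)
    also have "\<dots> = exp (- (pnorm a x powr a)) * indicator orthant x"
    proof (cases "x \<in> orthant")
      case True
      then have "\<bar>x $ i\<bar> = x $ i" for i by (simp add: orthant_def less_imp_le)
      then show ?thesis
        using assms by (simp add: pnorm_powr exp_sum[symmetric] sum_negf)
    qed simp
    finally show "ennreal (exp (- (pnorm a x powr a))) * indicator orthant x
        = ennreal (\<Prod>b\<in>Basis. g (x \<bullet> b))"
      by (simp add: indicator_def)
  qed
  also have "\<dots> = (\<integral>\<^sup>+x. (\<Prod>b\<in>Basis. ennreal (g (x \<bullet> b))) \<partial>(lborel :: (real ^ 'm) measure))"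
    by (intro nn_integral_cong prod_ennreal[symmetric]) (auto simp: g_def)
  also have "\<dots> = (\<Prod>b\<in>(Basis :: (real ^ 'm) set). (\<integral>\<^sup>+r. ennreal (g r) \<partial>lborel))"
    by (rule nn_integral_lborel_prod) auto
  also have "(\<integral>\<^sup>+r. ennreal (g r) \<partial>lborel) = (\<integral>\<^sup>+r. ennreal (exp (- (r powr a))) * indicator {0<..} r \<partial>lborel)"
    by (intro nn_integral_cong) (auto simp: g_def indicator_def)
  also have "\<dots> = (\<integral>\<^sup>+t. ennreal (exp (- (exp t powr a))) * ennreal (exp t) \<partial>lborel)"
    by (rule nn_integral_exp_substitution) measurable
  also have "\<dots> = (\<integral>\<^sup>+t. ennreal (exp (1 * t) * exp (- exp (a * t))) \<partial>lborel)"
    by (intro nn_integral_cong) (simp add: ennreal_mult[symmetric] powr_def mult.commute)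
  also have "\<dots> = ennreal (Gamma (1 / a) / a)"
    using assms by (intro nn_integral_Gamma_log_power) auto
  finally show ?thesis
    using assms by (simp add: ennreal_power Gamma_real_nonneg)
qed

text \<open>
  The surface constant of the orthant in dimension \<open>m\<close>: the integral of \<open>F(|x|)\<close> over the orthant is
  this constant times the integral of \<open>F(r) r^(m-1)\<close> over \<open>r > 0\<close>, for the norm with exponent \<open>a\<close>.
\<close>
definition sphere_const :: "real \<Rightarrow> nat \<Rightarrow> real" where
  "sphere_const a m = Gamma (1 / a) ^ m / (a ^ (m - 1) * Gamma (real m / a))"

lemma sphere_const_pos:
  assumes "a > 0" "m > 0"
  shows "sphere_const a m > 0"
  using assms by (simp add: sphere_const_def Gamma_real_pos)

text \<open>
  Integrate \<open>F(exp t |z|) exp (-|z|^a) |z|^m exp (m t)\<close> over all real \<open>t\<close> and all \<open>z\<close> in the orthant.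
  Translating \<open>t\<close> by \<open>ln |z|\<close> for fixed \<open>z\<close> gives the one-dimensional integral of \<open>F\<close> times
  the integral of \<open>exp (-|z|^a)\<close>; dilating \<open>z\<close> by \<open>exp t\<close> for fixed \<open>t\<close> gives the orthant integral
  of \<open>F(|x|)\<close> times a one-dimensional Gamma integral. The quotient of the two Gamma
  constants is the surface constant; no volume of a ball is needed.
\<close>
lemma nn_integral_polar:
  fixes F :: "real \<Rightarrow> ennreal"
  assumes a: "a > 0" and [measurable]: "F \<in> borel_measurable borel"
  shows "(\<integral>\<^sup>+x. F (pnorm a x) * indicator (orthant :: (real ^ 'm) set) x \<partial>lborel)
    = ennreal (sphere_const a CARD('m)) * (\<integral>\<^sup>+t. F (exp t) * ennreal (exp (real CARD('m) * t)) \<partial>lborel)"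
proof -
  let ?m = "CARD('m)"
  let ?O = "orthant :: (real ^ 'm) set"
  define E where "E r = exp (- (r powr a))" for r :: real
  have [measurable]: "E \<in> borel_measurable borel" unfolding E_def by measurable
  define P where "P = (\<integral>\<^sup>+t. F (exp t) * ennreal (exp (real ?m * t)) \<partial>lborel)"
  define A where "A = (Gamma (1 / a) / a) ^ ?m"
  define B where "B = Gamma (real ?m / a) / a"
  define H where "H t z = F (exp t * pnorm a z) * ennreal (E (pnorm a z) * pnorm a z ^ ?m)
      * ennreal (exp (real ?m * t)) * indicator ?O z" for t z
  have Hm: "(\<lambda>(t, z). H t z) \<in> borel_measurable (lborel \<Otimes>\<^sub>M lborel)"
    unfolding H_def by measurable
  have expm: "exp (real ?m * t) = exp t ^ ?m" for t
    by (simp add: exp_of_nat_mult)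
  have inner1: "(\<integral>\<^sup>+t. H t z \<partial>lborel) = P * (ennreal (E (pnorm a z)) * indicator ?O z)" for z
  proof (cases "z \<in> ?O")
    case True
    define r where "r = pnorm a z"
    have r: "r > 0" using True by (simp add: r_def pnorm_pos)
    have rm: "exp (real ?m * ln r) = r ^ ?m" using r by (simp add: expm)
    have "(\<integral>\<^sup>+t. H t z \<partial>lborel) = (\<integral>\<^sup>+t. (F (exp (t + ln r)) * ennreal (exp (real ?m * (t + ln r)))) * ennreal (E r) \<partial>lborel)"
      using True r
      by (intro nn_integral_cong)
         (simp add: H_def r_def[symmetric] distrib_left exp_add rm ennreal_mult E_def, simp add: mult_ac)
    also have "\<dots> = (\<integral>\<^sup>+t. (F (exp (t + ln r)) * ennreal (exp (real ?m * (t + ln r)))) \<partial>lborel) * ennreal (E r)"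
      by (rule nn_integral_multc) measurable
    also have "\<dots> = P * ennreal (E r)"
      unfolding P_def by (subst nn_integral_lborel_translate) auto
    finally show ?thesis using True by (simp add: r_def)
  qed (simp add: H_def)
  have inner2: "(\<integral>\<^sup>+z. H t z \<partial>lborel)
      = (\<integral>\<^sup>+x. F (pnorm a x) * ennreal (E (exp (- t) * pnorm a x) * (exp (- t) * pnorm a x) ^ ?m) * indicator ?O x \<partial>lborel)"
    (is "_ = (\<integral>\<^sup>+x. ?G x \<partial>lborel)") for t
  proof -
    have cancel: "exp (- t) * (exp t * r) = r" for r :: real
      by (simp add: mult.assoc[symmetric] exp_add[symmetric])
    have "(\<integral>\<^sup>+x. ?G x \<partial>lborel) = ennreal (exp t ^ ?m) * (\<integral>\<^sup>+x. ?G (exp t *\<^sub>R x) \<partial>lborel)"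
      by (subst nn_integral_lborel_scale) auto
    also have "\<dots> = (\<integral>\<^sup>+x. ennreal (exp t ^ ?m) * ?G (exp t *\<^sub>R x) \<partial>lborel)"
      by (rule nn_integral_cmult[symmetric]) measurable
    also have "\<dots> = (\<integral>\<^sup>+z. H t z \<partial>lborel)"
      using a by (intro nn_integral_cong)
        (simp add: H_def expm pnorm_scale orthant_scale cancel indicator_def, simp add: mult_ac)
    finally show ?thesis ..
  qed
  have inner3: "(\<integral>\<^sup>+t. F (pnorm a x) * ennreal (E (exp (- t) * pnorm a x) * (exp (- t) * pnorm a x) ^ ?m) * indicator ?O x \<partial>lborel)
      = ennreal B * (F (pnorm a x) * indicator ?O x)" for x
  proof (cases "x \<in> ?O")
    case True
    define r where "r = pnorm a x"
    have r: "r > 0" using True by (simp add: r_def pnorm_pos)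
    define h where "h t = ennreal (exp (real ?m * t) * exp (- exp (a * t)))" for t
    have [measurable]: "h \<in> borel_measurable borel" unfolding h_def by measurable
    have h: "ennreal (E (exp (- t) * r) * (exp (- t) * r) ^ ?m) = h (- t + ln r)" for t
    proof -
      have "exp (- t) * r = exp (- t + ln r)" using r by (simp only: exp_add exp_ln)
      then show ?thesis by (simp only: h_def E_def expm) (simp add: powr_def mult.commute)
    qed
    have "(\<integral>\<^sup>+t. F r * h (- t + ln r) \<partial>lborel) = F r * (\<integral>\<^sup>+t. h (- t + ln r) \<partial>lborel)"
      by (rule nn_integral_cmult) measurable
    also have "(\<integral>\<^sup>+t. h (- t + ln r) \<partial>lborel) = (\<integral>\<^sup>+t. h (t + ln r) \<partial>lborel)"
      by (rule nn_integral_lborel_uminus[of "\<lambda>t. h (t + ln r)"]) measurable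
    also have "\<dots> = (\<integral>\<^sup>+t. h t \<partial>lborel)"
      by (rule nn_integral_lborel_translate) measurable
    also have "\<dots> = ennreal B"
      unfolding h_def B_def using a by (intro nn_integral_Gamma_log_power) auto
    finally show ?thesis
      using True by (simp add: r_def[symmetric] h mult.commute[of _ "F r"] del: uminus_add_conv_diff)
  qed simp
  have "P * ennreal A = (\<integral>\<^sup>+z. P * (ennreal (E (pnorm a z)) * indicator ?O z) \<partial>lborel)"
    unfolding A_def E_def nn_integral_orthant_exp_pnorm[OF a, symmetric]
    by (rule nn_integral_cmult[symmetric]) measurable
  also have "\<dots> = (\<integral>\<^sup>+z. \<integral>\<^sup>+t. H t z \<partial>lborel \<partial>lborel)"
    by (simp add: inner1)
  also have "\<dots> = (\<integral>\<^sup>+t. \<integral>\<^sup>+z. H t z \<partial>lborel \<partial>lborel)"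
    by (rule lborel_pair.Fubini'[OF Hm])
  also have "\<dots> = (\<integral>\<^sup>+x. \<integral>\<^sup>+t. F (pnorm a x) * ennreal (E (exp (- t) * pnorm a x) * (exp (- t) * pnorm a x) ^ ?m) * indicator ?O x \<partial>lborel \<partial>lborel)"
    unfolding inner2 by (rule lborel_pair.Fubini'[symmetric]) measurable
  also have "\<dots> = ennreal B * (\<integral>\<^sup>+x. F (pnorm a x) * indicator ?O x \<partial>lborel)"
    unfolding inner3 by (rule nn_integral_cmult) measurable
  finally have eq: "P * ennreal A = ennreal B * (\<integral>\<^sup>+x. F (pnorm a x) * indicator ?O x \<partial>lborel)" .
  have B: "B > 0" and A0: "A \<ge> 0"
    using a by (auto simp: B_def A_def Gamma_real_pos Gamma_real_nonneg)
  have "A / B = sphere_const a ?m"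
    using a by (cases "CARD('m)")
      (simp_all add: A_def B_def sphere_const_def field_simps power_divide)
  then have "ennreal (sphere_const a ?m) * P = ennreal (1 / B) * (P * ennreal A)"
    using A0 B by (simp add: ennreal_mult[symmetric] mult_ac)
  also have "\<dots> = (ennreal (1 / B) * ennreal B) * (\<integral>\<^sup>+x. F (pnorm a x) * indicator ?O x \<partial>lborel)"
    by (simp add: eq mult.assoc)
  also have "ennreal (1 / B) * ennreal B = 1"
    using B by (simp add: ennreal_mult[symmetric])
  finally show ?thesis by (simp add: P_def)
qed

section \<open>The kernel and its Mellin transform\<close>

lemma coth_minus_one:
  assumes "u > 0"
  shows "coth u - 1 = 2 / (exp (2 * u) - 1)"
proof -
  have "exp u * exp u = exp (2 * u)" by (simp add: exp_add[symmetric])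
  moreover have "exp u > 1" "exp (2 * u) > 1" using assms by auto
  moreover have "exp u * exp u > 1" using calculation by simp
  ultimately show ?thesis
    unfolding coth_def exp_minus by (simp add: field_simps)
qed

lemma coth_minus_one_nonneg: "u > 0 \<Longrightarrow> coth u - 1 \<ge> 0"
  by (simp only: coth_minus_one) simp

lemma coth_minus_one_sums:
  assumes "u > 0"
  shows "(\<lambda>k. 2 * exp (- (2 * real (Suc k) * u))) sums (coth u - 1)"
proof -
  define z where "z = exp (- (2 * u))"
  have z: "z > 0" "z < 1" using assms by (auto simp: z_def)
  have "(\<lambda>k. z ^ k) sums (1 / (1 - z))"
    using z by (intro geometric_sums) simp
  then have "(\<lambda>k. (2 * z) * z ^ k) sums ((2 * z) * (1 / (1 - z)))"
    by (rule sums_mult)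
  also have "(\<lambda>k. (2 * z) * z ^ k) = (\<lambda>k. 2 * exp (- (2 * real (Suc k) * u)))"
    by (auto simp: z_def exp_of_nat_mult[symmetric] exp_add[symmetric] algebra_simps)
  also have "(2 * z) * (1 / (1 - z)) = coth u - 1"
    using z assms unfolding coth_minus_one[OF assms] z_def exp_minus
    by (simp add: field_simps)
  finally show ?thesis .
qed

lemma coth_borel [measurable]: "coth \<in> borel_measurable borel"
  unfolding coth_def by measurable

lemma coth_minus_one_le_inverse:
  assumes "u > 0"
  shows "coth u - 1 \<le> 1 / u"
proof -
  have "2 * u \<le> exp (2 * u) - 1" using exp_ge_add_one_self[of "2 * u"] by linarith
  then have "2 / (exp (2 * u) - 1) \<le> 2 / (2 * u)" using assms by (intro divide_left_mono) auto
  then show ?thesis using assms by (simp add: coth_minus_one)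
qed

lemma coth_minus_one_le_exp:
  assumes "u \<ge> 1"
  shows "coth u - 1 \<le> 4 * exp (- (2 * u))"
proof -
  have "2 \<le> exp (2 * u)" using exp_ge_add_one_self[of "2 * u"] assms by linarith
  then have "2 / (exp (2 * u) - 1) \<le> 2 / (exp (2 * u) / 2)"
    by (intro divide_left_mono mult_pos_pos) linarith+
  then show ?thesis using assms by (simp add: coth_minus_one exp_minus field_simps)
qed

text \<open>
  Near \<open>0\<close> the factor \<open>coth u - 1\<close> is at most \<open>1 / u\<close>, which \<open>u powr \<sigma>\<close> compensates because
  \<open>\<sigma> > 1\<close>; for large \<open>u\<close> it decays exponentially. This makes the operator well defined at every
  point of the orthant and not only almost everywhere.
\<close>
lemma coth_minus_one_powr_bounded:
  assumes "\<sigma> > 1" "u > 0"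
  shows "(coth u - 1) * u powr \<sigma> \<le> 1 + 4 * \<sigma> powr \<sigma>"
proof (cases "u \<le> 1")
  case True
  have "(coth u - 1) * u powr \<sigma> \<le> 1 / u * u powr \<sigma>"
    using assms by (intro mult_right_mono coth_minus_one_le_inverse) auto
  also have "\<dots> = u powr (\<sigma> - 1)" using assms by (simp add: powr_diff)
  also have "\<dots> \<le> 1 powr (\<sigma> - 1)" using assms True by (intro powr_mono2) auto
  finally show ?thesis by (simp add: add_increasing2)
next
  case False
  \<comment> \<open>Raising \<open>u / \<sigma> \<le> exp (u / \<sigma>)\<close> to the power \<open>\<sigma>\<close> trades \<open>u powr \<sigma>\<close> for \<open>exp u\<close>.\<close>
  have "u / \<sigma> \<le> exp (u / \<sigma>)" using exp_ge_add_one_self[of "u / \<sigma>"] by linarith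
  then have "u \<le> \<sigma> * exp (u / \<sigma>)" using assms by (simp add: field_simps)
  then have "u powr \<sigma> \<le> (\<sigma> * exp (u / \<sigma>)) powr \<sigma>"
    using assms by (intro powr_mono2) auto
  also have "\<dots> = \<sigma> powr \<sigma> * exp u"
    using assms by (simp add: powr_mult) (simp add: powr_def)
  finally have "(coth u - 1) * u powr \<sigma> \<le> 4 * exp (- (2 * u)) * (\<sigma> powr \<sigma> * exp u)"
    using False by (intro mult_mono coth_minus_one_le_exp) auto
  also have "\<dots> = 4 * \<sigma> powr \<sigma> * exp (- u)"
    by (simp add: exp_add[symmetric])
  also have "\<dots> \<le> 4 * \<sigma> powr \<sigma> * 1"
    using False by (intro mult_left_mono) auto
  finally show ?thesis by simp
qed

text \<open>
  The Mellin transform of \<open>coth u - 1\<close> at \<open>\<sigma>\<close>, in closed form; \<open>nn_integral_coth_minus_one\<close>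
  below identifies it with the integral in the coordinate \<open>t = ln u\<close>.
\<close>
definition coth_mellin :: "real \<Rightarrow> real" where
  "coth_mellin \<sigma> = Gamma \<sigma> / 2 powr (\<sigma> - 1) * zeta \<sigma>"

lemma summable_zeta:
  assumes "\<sigma> > 1"
  shows "summable (\<lambda>k. real (Suc k) powr (- \<sigma>))"
proof -
  have "summable (\<lambda>k. real k powr (- \<sigma>))" using assms by (simp add: summable_real_powr_iff)
  then show ?thesis by (subst summable_Suc_iff)
qed

lemma coth_mellin_pos:
  assumes "\<sigma> > 1"
  shows "coth_mellin \<sigma> > 0"
proof -
  have "zeta \<sigma> > 0" unfolding zeta_def
    by (intro suminf_pos summable_zeta assms) auto
  then show ?thesis using assms by (simp add: coth_mellin_def Gamma_real_pos)
qed

lemma nn_integral_coth_minus_one: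
  assumes "\<sigma> > 1"
  shows "(\<integral>\<^sup>+t. ennreal (coth (exp t) - 1) * ennreal (exp (\<sigma> * t)) \<partial>lborel) = ennreal (coth_mellin \<sigma>)"
proof -
  let ?g = "\<lambda>k t. ennreal (2 * exp (- (2 * real (Suc k) * exp t))) * ennreal (exp (\<sigma> * t))"
  have "(\<integral>\<^sup>+t. ennreal (coth (exp t) - 1) * ennreal (exp (\<sigma> * t)) \<partial>lborel)
      = (\<integral>\<^sup>+t. (\<Sum>k. ?g k t) \<partial>lborel)"
  proof (intro nn_integral_cong)
    fix t :: real
    have "(\<Sum>k. ennreal (2 * exp (- (2 * real (Suc k) * exp t)))) = ennreal (coth (exp t) - 1)"
      using coth_minus_one_sums[of "exp t"] by (intro suminf_ennreal_eq) auto
    then show "ennreal (coth (exp t) - 1) * ennreal (exp (\<sigma> * t)) = (\<Sum>k. ?g k t)"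
      by simp
  qed
  also have "\<dots> = (\<Sum>k. \<integral>\<^sup>+t. ?g k t \<partial>lborel)"
    by (rule nn_integral_suminf) measurable
  also have "\<dots> = (\<Sum>k. ennreal (2 * 2 powr (- \<sigma>) * Gamma \<sigma> * real (Suc k) powr (- \<sigma>)))"
  proof (intro suminf_cong)
    fix k
    define h where "h t = ennreal (exp (\<sigma> * t) * exp (- exp t))" for t
    have [measurable]: "h \<in> borel_measurable borel" unfolding h_def by measurable
    define c where "c = 2 * real (Suc k)"
    have c: "c > 0" by (simp add: c_def)
    have "(\<integral>\<^sup>+t. ?g k t \<partial>lborel) = (\<integral>\<^sup>+t. ennreal (2 * c powr (- \<sigma>)) * h (t + ln c) \<partial>lborel)"
    proof (intro nn_integral_cong)
      fix t
      have "exp (t + ln c) = c * exp t" using c by (simp add: exp_add)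
      moreover have "exp (\<sigma> * (t + ln c)) = exp (\<sigma> * t) * c powr \<sigma>"
        using c by (simp add: powr_def exp_add distrib_left)
      moreover have "c powr (- \<sigma>) * c powr \<sigma> = 1" using c by (simp add: powr_add[symmetric])
      ultimately show "?g k t = ennreal (2 * c powr (- \<sigma>)) * h (t + ln c)"
        unfolding c_def[symmetric] by (simp add: h_def ennreal_mult[symmetric])
    qed
    also have "\<dots> = ennreal (2 * c powr (- \<sigma>)) * (\<integral>\<^sup>+t. h (t + ln c) \<partial>lborel)"
      by (rule nn_integral_cmult) measurable
    also have "(\<integral>\<^sup>+t. h (t + ln c) \<partial>lborel) = (\<integral>\<^sup>+t. h t \<partial>lborel)"
      by (rule nn_integral_lborel_translate) measurable
    also have "\<dots> = ennreal (Gamma \<sigma>)"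
      unfolding h_def using assms by (intro nn_integral_Gamma_log) simp
    moreover have "c powr (- \<sigma>) = 2 powr (- \<sigma>) * real (Suc k) powr (- \<sigma>)"
      unfolding c_def by (rule powr_mult)
    ultimately show "(\<integral>\<^sup>+t. ?g k t \<partial>lborel) = ennreal (2 * 2 powr (- \<sigma>) * Gamma \<sigma> * real (Suc k) powr (- \<sigma>))"
      using assms by (simp add: ennreal_mult[symmetric] Gamma_real_nonneg mult_ac)
  qed
  also have "\<dots> = ennreal (2 * 2 powr (- \<sigma>) * Gamma \<sigma> * zeta \<sigma>)"
    unfolding zeta_def using assms
    by (intro suminf_ennreal_eq sums_mult summable_sums summable_zeta) (auto simp: Gamma_real_nonneg)
  also have "2 * 2 powr (- \<sigma>) * Gamma \<sigma> * zeta \<sigma> = coth_mellin \<sigma>"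
    by (simp add: coth_mellin_def powr_diff powr_minus field_simps)
  finally show ?thesis .
qed

text \<open>
  Polar integration against a power of the norm, in the two forms in which the kernel occurs:
  as a function of \<open>|x| / s\<close>, and as a function of \<open>s / |x|\<close>.
\<close>
lemma nn_integral_polar_scaled:
  fixes G :: "real \<Rightarrow> ennreal"
  assumes a: "a > 0" and s: "s > 0" and [measurable]: "G \<in> borel_measurable borel"
  shows "(\<integral>\<^sup>+x. G (pnorm a x / s) * ennreal (pnorm a x powr (b - real CARD('m)))
            * indicator (orthant :: (real ^ 'm) set) x \<partial>lborel)
    = ennreal (sphere_const a CARD('m) * s powr b) * (\<integral>\<^sup>+t. G (exp t) * ennreal (exp (b * t)) \<partial>lborel)"
proof -
  let ?m = "real CARD('m)"
  have "(\<integral>\<^sup>+x. G (pnorm a x / s) * ennreal (pnorm a x powr (b - ?m))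
            * indicator (orthant :: (real ^ 'm) set) x \<partial>lborel)
      = ennreal (sphere_const a CARD('m)) *
        (\<integral>\<^sup>+t. (G (exp t / s) * ennreal (exp t powr (b - ?m))) * ennreal (exp (?m * t)) \<partial>lborel)"
    by (rule nn_integral_polar[OF a, of "\<lambda>r. G (r / s) * ennreal (r powr (b - ?m))"]) measurable
  also have "(\<integral>\<^sup>+t. (G (exp t / s) * ennreal (exp t powr (b - ?m))) * ennreal (exp (?m * t)) \<partial>lborel)
      = (\<integral>\<^sup>+t. ennreal (s powr b) * (G (exp (t + - ln s)) * ennreal (exp (b * (t + - ln s)))) \<partial>lborel)"
  proof (intro nn_integral_cong)
    fix t
    have "exp (t + - ln s) = exp t / s" using s by (simp only: exp_add exp_minus exp_ln divide_inverse)
    moreover have "exp t powr (b - ?m) * exp (?m * t) = s powr b * exp (b * (t + - ln s))"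
      using s by (simp add: powr_def exp_add[symmetric] algebra_simps)
    ultimately show "(G (exp t / s) * ennreal (exp t powr (b - ?m))) * ennreal (exp (?m * t))
        = ennreal (s powr b) * (G (exp (t + - ln s)) * ennreal (exp (b * (t + - ln s))))"
      by (simp add: ennreal_mult[symmetric] mult.assoc mult.left_commute[of "ennreal (s powr b)"])
  qed
  also have "\<dots> = ennreal (s powr b) * (\<integral>\<^sup>+t. G (exp (t + - ln s)) * ennreal (exp (b * (t + - ln s))) \<partial>lborel)"
    by (rule nn_integral_cmult) measurable
  also have "(\<integral>\<^sup>+t. G (exp (t + - ln s)) * ennreal (exp (b * (t + - ln s))) \<partial>lborel)
      = (\<integral>\<^sup>+t. G (exp t) * ennreal (exp (b * t)) \<partial>lborel)"
    by (rule nn_integral_lborel_translate[of "\<lambda>t. G (exp t) * ennreal (exp (b * t))"]) measurable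
  finally show ?thesis
    using sphere_const_pos[OF a, of "CARD('m)"] by (simp add: ennreal_mult mult.assoc)
qed

lemma nn_integral_polar_reflected:
  fixes G :: "real \<Rightarrow> ennreal"
  assumes a: "a > 0" and s: "s > 0" and [measurable]: "G \<in> borel_measurable borel"
  shows "(\<integral>\<^sup>+x. G (s / pnorm a x) * ennreal (pnorm a x powr (- b - real CARD('m)))
            * indicator (orthant :: (real ^ 'm) set) x \<partial>lborel)
    = ennreal (sphere_const a CARD('m) * s powr (- b)) * (\<integral>\<^sup>+t. G (exp t) * ennreal (exp (b * t)) \<partial>lborel)"
proof -
  have "(\<integral>\<^sup>+x. G (s / pnorm a x) * ennreal (pnorm a x powr (- b - real CARD('m)))
            * indicator (orthant :: (real ^ 'm) set) x \<partial>lborel)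
    = ennreal (sphere_const a CARD('m) * s powr (- b)) *
      (\<integral>\<^sup>+t. G (1 / exp t) * ennreal (exp ((- b) * t)) \<partial>lborel)"
    using nn_integral_polar_scaled[OF a s, of "\<lambda>r. G (1 / r)" "- b", where 'm='m] by simp
  also have "(\<integral>\<^sup>+t. G (1 / exp t) * ennreal (exp ((- b) * t)) \<partial>lborel)
      = (\<integral>\<^sup>+t. G (exp (- t)) * ennreal (exp (b * (- t))) \<partial>lborel)"
    by (simp add: exp_minus divide_inverse)
  also have "\<dots> = (\<integral>\<^sup>+t. G (exp t) * ennreal (exp (b * t)) \<partial>lborel)"
    by (rule nn_integral_lborel_uminus[of "\<lambda>t. G (exp t) * ennreal (exp (b * t))"]) measurable
  finally show ?thesis .
qed

section \<open>The upper bound\<close>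

lemma conjugate_exponent:
  assumes "p > 1" "1 / p + 1 / q = (1 :: real)"
  shows "q > 1" "p / q = p - 1" "q * (1 - p) = - p"
proof -
  have "1 / p < 1" "1 / p > 0" using assms by auto
  then have iq: "1 / q > 0" "1 / q < 1" using assms(2) by linarith+
  then have "q > 0" by (simp only: zero_less_divide_1_iff)
  with iq show q: "q > 1" by (simp add: field_simps)
  have "q + p = p * q" using assms q by (simp add: field_simps)
  then show "p / q = p - 1" "q * (1 - p) = - p"
    using assms q by (auto simp: field_simps)
qed

lemma nn_integral_Holder:
  fixes f g :: "'a \<Rightarrow> real"
  assumes p: "p > 1" and pq: "1 / p + 1 / q = 1"
    and [measurable]: "f \<in> borel_measurable M" "g \<in> borel_measurable M"
    and nn: "\<And>x. f x \<ge> 0" "\<And>x. g x \<ge> 0"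
    and A: "A \<ge> 0" "(\<integral>\<^sup>+x. ennreal (f x powr p) \<partial>M) = ennreal A"
    and B: "B > 0" "(\<integral>\<^sup>+x. ennreal (g x powr q) \<partial>M) = ennreal B"
  shows "(\<integral>\<^sup>+x. ennreal (f x * g x) \<partial>M) \<le> ennreal (A powr (1 / p) * B powr (1 / q))"
proof (cases "A = 0")
  case True
  then have "(\<integral>\<^sup>+x. ennreal (f x powr p) \<partial>M) = 0" using A by simp
  then have "AE x in M. ennreal (f x powr p) = 0"
    by (subst (asm) nn_integral_0_iff_AE) auto
  then have "AE x in M. ennreal (f x * g x) = 0"
    by eventually_elim (use nn in auto)
  then have "(\<integral>\<^sup>+x. ennreal (f x * g x) \<partial>M) = 0"
    by (subst nn_integral_0_iff_AE) auto
  then show ?thesis by simp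
next
  case False
  with A have A0: "A > 0" by simp
  have q: "q > 1" using conjugate_exponent[OF p pq] by simp
  define a where "a = A powr (1 / p)"
  define b where "b = B powr (1 / q)"
  have a: "a > 0" "a powr p = A" using A0 p by (auto simp: a_def powr_powr)
  have b: "b > 0" "b powr q = B" using B q by (auto simp: b_def powr_powr)
  \<comment> \<open>Young's inequality for the functions normalised by \<open>a\<close> and \<open>b\<close>.\<close>
  have "ennreal (f x * g x) \<le> ennreal (a * b / (p * A)) * ennreal (f x powr p) + ennreal (a * b / (q * B)) * ennreal (g x powr q)" for x
  proof -
    have "(f x / a) * (g x / b) \<le> (f x / a) powr p / p + (g x / b) powr q / q"
      using p q pq nn a b by (intro Youngs_inequality) auto
    then have "(a * b) * ((f x / a) * (g x / b)) \<le> (a * b) * ((f x / a) powr p / p + (g x / b) powr q / q)"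
      using a b by (intro mult_left_mono) auto
    also have "(a * b) * ((f x / a) * (g x / b)) = f x * g x" using a b by simp
    also have "(a * b) * ((f x / a) powr p / p + (g x / b) powr q / q)
        = a * b / (p * A) * f x powr p + a * b / (q * B) * g x powr q"
      using nn[of x] a b by (simp add: powr_divide distrib_left mult.commute)
    finally have le: "f x * g x \<le> a * b / (p * A) * f x powr p + a * b / (q * B) * g x powr q" .
    have nonneg: "a * b / (p * A) \<ge> 0" "a * b / (q * B) \<ge> 0" using a b A0 B p q by auto
    show ?thesis
      unfolding ennreal_mult[OF nonneg(1) powr_ge_zero, symmetric]
        ennreal_mult[OF nonneg(2) powr_ge_zero, symmetric]
      using le nonneg
      by (subst ennreal_plus[symmetric]) (intro mult_nonneg_nonneg powr_ge_zero ennreal_leI | assumption)+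
  qed
  then have "(\<integral>\<^sup>+x. ennreal (f x * g x) \<partial>M)
      \<le> (\<integral>\<^sup>+x. ennreal (a * b / (p * A)) * ennreal (f x powr p) + ennreal (a * b / (q * B)) * ennreal (g x powr q) \<partial>M)"
    by (intro nn_integral_mono)
  also have "\<dots> = ennreal (a * b / (p * A)) * ennreal A + ennreal (a * b / (q * B)) * ennreal B"
    by (simp add: nn_integral_add nn_integral_cmult A B)
  also have "\<dots> = ennreal (a * b / p + a * b / q)"
    using a b A0 B p q by (simp add: ennreal_mult[symmetric] ennreal_plus[symmetric] del: ennreal_plus)
  also have "a * b / p + a * b / q = a * b * (1 / p + 1 / q)" by (simp add: algebra_simps)
  finally show ?thesis using pq by (simp add: a_def b_def)
qed

lemma coth_kernel_nonneg:
  assumes "x \<in> orthant" "y \<in> orthant"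
  shows "coth_kernel \<alpha> \<beta> x y \<ge> 0"
  unfolding coth_kernel_def using assms by (intro coth_minus_one_nonneg) (auto simp: pnorm_pos)

lemma coth_kernel_measurable [measurable]:
  "(\<lambda>(x, y). coth_kernel \<alpha> \<beta> x y) \<in> borel_measurable (borel \<Otimes>\<^sub>M borel)"
  "coth_kernel \<alpha> \<beta> x \<in> borel_measurable borel"
  "(\<lambda>x. coth_kernel \<alpha> \<beta> x y) \<in> borel_measurable borel"
  unfolding coth_kernel_def by measurable

lemma coth_kernel_integral_x:
  assumes "\<alpha> > 0" "\<sigma> > 1" "y \<in> orthant"
  shows "(\<integral>\<^sup>+x. ennreal (coth_kernel \<alpha> \<beta> x y * pnorm \<alpha> x powr (\<sigma> - real CARD('m)))
        * indicator (orthant :: (real ^ 'm) set) x \<partial>lborel)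
    = ennreal (sphere_const \<alpha> CARD('m) * coth_mellin \<sigma> * pnorm \<beta> y powr \<sigma>)"
proof -
  have "(\<integral>\<^sup>+x. ennreal (coth_kernel \<alpha> \<beta> x y * pnorm \<alpha> x powr (\<sigma> - real CARD('m)))
        * indicator (orthant :: (real ^ 'm) set) x \<partial>lborel)
      = (\<integral>\<^sup>+x. ennreal (coth (pnorm \<alpha> x / pnorm \<beta> y) - 1) * ennreal (pnorm \<alpha> x powr (\<sigma> - real CARD('m)))
        * indicator (orthant :: (real ^ 'm) set) x \<partial>lborel)"
  proof (intro nn_integral_cong)
    fix x :: "real ^ 'm"
    show "ennreal (coth_kernel \<alpha> \<beta> x y * pnorm \<alpha> x powr (\<sigma> - real CARD('m))) * indicator orthant x
      = ennreal (coth (pnorm \<alpha> x / pnorm \<beta> y) - 1) * ennreal (pnorm \<alpha> x powr (\<sigma> - real CARD('m))) * indicator orthant x"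
      using coth_kernel_nonneg[of x y \<alpha> \<beta>] assms
      by (cases "x \<in> orthant") (auto simp: coth_kernel_def ennreal_mult)
  qed
  also have "\<dots> = ennreal (sphere_const \<alpha> CARD('m) * pnorm \<beta> y powr \<sigma>) *
      (\<integral>\<^sup>+t. ennreal (coth (exp t) - 1) * ennreal (exp (\<sigma> * t)) \<partial>lborel)"
    using assms by (intro nn_integral_polar_scaled pnorm_pos) auto
  also note nn_integral_coth_minus_one[OF assms(2)]
  finally show ?thesis
    using assms coth_mellin_pos[of \<sigma>] sphere_const_pos[of \<alpha> "CARD('m)"]
    by (simp add: ennreal_mult[symmetric] mult_ac)
qed

lemma coth_kernel_integral_y:
  assumes "\<beta> > 0" "\<sigma> > 1" "x \<in> orthant"
  shows "(\<integral>\<^sup>+y. ennreal (coth_kernel \<alpha> \<beta> x y * pnorm \<beta> y powr (- \<sigma> - real CARD('n)))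
        * indicator (orthant :: (real ^ 'n) set) y \<partial>lborel)
    = ennreal (sphere_const \<beta> CARD('n) * coth_mellin \<sigma> * pnorm \<alpha> x powr (- \<sigma>))"
proof -
  have "(\<integral>\<^sup>+y. ennreal (coth_kernel \<alpha> \<beta> x y * pnorm \<beta> y powr (- \<sigma> - real CARD('n)))
        * indicator (orthant :: (real ^ 'n) set) y \<partial>lborel)
      = (\<integral>\<^sup>+y. ennreal (coth (pnorm \<alpha> x / pnorm \<beta> y) - 1) * ennreal (pnorm \<beta> y powr (- \<sigma> - real CARD('n)))
        * indicator (orthant :: (real ^ 'n) set) y \<partial>lborel)"
  proof (intro nn_integral_cong)
    fix y :: "real ^ 'n"
    show "ennreal (coth_kernel \<alpha> \<beta> x y * pnorm \<beta> y powr (- \<sigma> - real CARD('n))) * indicator orthant y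
      = ennreal (coth (pnorm \<alpha> x / pnorm \<beta> y) - 1) * ennreal (pnorm \<beta> y powr (- \<sigma> - real CARD('n))) * indicator orthant y"
      using coth_kernel_nonneg[of x y \<alpha> \<beta>] assms
      by (cases "y \<in> orthant") (auto simp: coth_kernel_def ennreal_mult)
  qed
  also have "\<dots> = ennreal (sphere_const \<beta> CARD('n) * pnorm \<alpha> x powr (- \<sigma>)) *
      (\<integral>\<^sup>+t. ennreal (coth (exp t) - 1) * ennreal (exp (\<sigma> * t)) \<partial>lborel)"
    using assms by (intro nn_integral_polar_reflected pnorm_pos) auto
  also note nn_integral_coth_minus_one[OF assms(2)]
  finally show ?thesis
    using assms coth_mellin_pos[of \<sigma>] sphere_const_pos[of \<beta> "CARD('n)"]
    by (simp add: ennreal_mult[symmetric] mult_ac)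
qed

text \<open>
  The \<open>p\<close>-th power side of the Hoelder split: the integral of
  \<open>k(|x| / |y|) |x|^((m-\<sigma>)(p-1)) g(x)^p\<close> over the orthant, where \<open>k(u) = coth u - 1\<close>.
\<close>
definition schur_integral ::
    "real \<Rightarrow> real \<Rightarrow> real \<Rightarrow> real \<Rightarrow> (real ^ 'm \<Rightarrow> real) \<Rightarrow> real ^ 'n \<Rightarrow> ennreal" where
  "schur_integral \<alpha> \<beta> \<sigma> p g y =
     (\<integral>\<^sup>+x. ennreal (coth_kernel \<alpha> \<beta> x y * (pnorm \<alpha> x powr ((real CARD('m) - \<sigma>) * (p - 1)) * g x powr p))
        * indicator orthant x \<partial>lborel)"

lemma schur_integral_finite:
  fixes g :: "real ^ 'm \<Rightarrow> real" and y :: "real ^ 'n"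
  assumes \<alpha>: "\<alpha> > 0" and \<sigma>: "\<sigma> > 1" and y: "y \<in> orthant"
    and [measurable]: "g \<in> borel_measurable borel"
    and fin: "(\<integral>\<^sup>+x. ennreal (weight_Phi \<alpha> \<sigma> p x * g x powr p) * indicator orthant x \<partial>lborel) < \<infinity>"
  shows "schur_integral \<alpha> \<beta> \<sigma> p g y < \<infinity>"
proof -
  let ?m = "real CARD('m)"
  define M where "M = (1 + 4 * \<sigma> powr \<sigma>) * pnorm \<beta> y powr \<sigma>"
  have M: "M \<ge> 0" by (simp add: M_def)
  have "schur_integral \<alpha> \<beta> \<sigma> p g y
    \<le> (\<integral>\<^sup>+x. ennreal M * (ennreal (weight_Phi \<alpha> \<sigma> p x * g x powr p) * indicator orthant x) \<partial>lborel)"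
    unfolding schur_integral_def
  proof (intro nn_integral_mono)
    fix x :: "real ^ 'm"
    show "ennreal (coth_kernel \<alpha> \<beta> x y * (pnorm \<alpha> x powr ((?m - \<sigma>) * (p - 1)) * g x powr p)) * indicator orthant x
      \<le> ennreal M * (ennreal (weight_Phi \<alpha> \<sigma> p x * g x powr p) * indicator orthant x)"
    proof (cases "x \<in> orthant")
      case True
      define r s where "r = pnorm \<alpha> x" and "s = pnorm \<beta> y"
      have rs: "r > 0" "s > 0" using True y by (auto simp: r_def s_def pnorm_pos)
      have "coth_kernel \<alpha> \<beta> x y * r powr \<sigma> = ((coth (r / s) - 1) * (r / s) powr \<sigma>) * s powr \<sigma>"
        using rs by (simp add: coth_kernel_def r_def s_def powr_divide)
      also have "\<dots> \<le> M"
        unfolding M_def s_def[symmetric] using rs \<sigma>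
        by (intro mult_right_mono coth_minus_one_powr_bounded) auto
      finally have "coth_kernel \<alpha> \<beta> x y * r powr \<sigma> * (weight_Phi \<alpha> \<sigma> p x * g x powr p)
          \<le> M * (weight_Phi \<alpha> \<sigma> p x * g x powr p)"
        by (intro mult_right_mono) (auto simp: weight_Phi_def)
      also have "coth_kernel \<alpha> \<beta> x y * r powr \<sigma> * (weight_Phi \<alpha> \<sigma> p x * g x powr p)
          = coth_kernel \<alpha> \<beta> x y * (r powr (\<sigma> + (p * (?m - \<sigma>) - ?m)) * g x powr p)"
        by (simp add: weight_Phi_def r_def[symmetric] powr_add)
      also have "\<sigma> + (p * (?m - \<sigma>) - ?m) = (?m - \<sigma>) * (p - 1)" by (simp add: algebra_simps)
      finally show ?thesis
        using True M by (simp add: r_def ennreal_mult'[symmetric] ennreal_leI)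
    qed simp
  qed
  also have "\<dots> = ennreal M * (\<integral>\<^sup>+x. ennreal (weight_Phi \<alpha> \<sigma> p x * g x powr p) * indicator orthant x \<partial>lborel)"
    unfolding weight_Phi_def by (rule nn_integral_cmult) measurable
  also have "\<dots> < \<infinity>" using fin by (simp add: ennreal_mult_less_top)
  finally show ?thesis .
qed

text \<open>
  The Hoelder inequality for the functions \<open>u\<close> and \<open>v\<close> that share out the kernel with exponents
  \<open>1/p\<close> and \<open>1/q\<close> and carry the weights \<open>|x|^((m-\<sigma>)/q)\<close> and \<open>|x|^((\<sigma>-m)/q)\<close>. The number \<open>I\<close> is the
  operator with absolute values, evaluated at \<open>y\<close>.
\<close>
lemma coth_operator_pointwise:
  fixes g :: "real ^ 'm \<Rightarrow> real" and y :: "real ^ 'n"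
  assumes \<alpha>: "\<alpha> > 0" and \<sigma>: "\<sigma> > 1" and p: "p > 1" and pq: "1 / p + 1 / q = 1" and y: "y \<in> orthant"
    and [measurable]: "g \<in> borel_measurable borel" and g: "\<And>x. g x \<ge> 0"
    and fin: "(\<integral>\<^sup>+x. ennreal (weight_Phi \<alpha> \<sigma> p x * g x powr p) * indicator orthant x \<partial>lborel) < \<infinity>"
  obtains I where "I \<ge> 0"
    "(\<integral>\<^sup>+x. ennreal (coth_kernel \<alpha> \<beta> x y * g x) * indicator orthant x \<partial>lborel) = ennreal I"
    "ennreal (I powr p) \<le> ennreal ((sphere_const \<alpha> CARD('m) * coth_mellin \<sigma> * pnorm \<beta> y powr \<sigma>) powr (p - 1))
       * schur_integral \<alpha> \<beta> \<sigma> p g y"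
proof -
  let ?m = "real CARD('m)"
  define B where "B = sphere_const \<alpha> CARD('m) * coth_mellin \<sigma> * pnorm \<beta> y powr \<sigma>"
  have B: "B > 0"
    using coth_mellin_pos[OF \<sigma>] sphere_const_pos[OF \<alpha>, of "CARD('m)"] pnorm_pos[OF y, of \<beta>]
    by (simp add: B_def)
  define A where "A = enn2real (schur_integral \<alpha> \<beta> \<sigma> p g y)"
  have A: "A \<ge> 0" "schur_integral \<alpha> \<beta> \<sigma> p g y = ennreal A"
    using schur_integral_finite[OF \<alpha> \<sigma> y _ fin, of \<beta>] by (auto simp: A_def)
  note conj = conjugate_exponent[OF p pq]
  define k where "k x = coth_kernel \<alpha> \<beta> x y * indicator orthant x" for x :: "real ^ 'm"
  have k: "k x \<ge> 0" for x
    using coth_kernel_nonneg[of x y \<alpha> \<beta>] y by (auto simp: k_def indicator_def)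
  have [measurable]: "k \<in> borel_measurable borel" unfolding k_def by measurable
  define u where "u x = k x powr (1 / p) * pnorm \<alpha> x powr ((?m - \<sigma>) / q) * g x" for x
  define v where "v x = k x powr (1 / q) * pnorm \<alpha> x powr ((\<sigma> - ?m) / q)" for x
  have uv: "u x * v x = coth_kernel \<alpha> \<beta> x y * g x * indicator orthant x" for x
  proof (cases "x \<in> orthant")
    case True
    have "k x powr (1 / p) * k x powr (1 / q) = k x"
      using k[of x] pq by (simp add: powr_add[symmetric])
    moreover have "pnorm \<alpha> x powr ((?m - \<sigma>) / q) * pnorm \<alpha> x powr ((\<sigma> - ?m) / q) = 1"
      using pnorm_pos[OF True, of \<alpha>] by (simp add: powr_add[symmetric] add_divide_distrib[symmetric])
    ultimately show ?thesis
      using True by (simp add: u_def v_def k_def mult_ac)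
  qed (simp add: u_def k_def)
  have up: "ennreal (u x powr p) = ennreal (coth_kernel \<alpha> \<beta> x y * (pnorm \<alpha> x powr ((?m - \<sigma>) * (p - 1)) * g x powr p))
        * indicator orthant x" for x
  proof -
    have "(?m - \<sigma>) / q * p = (?m - \<sigma>) * (p - 1)" using conj(2) by (metis times_divide_eq_left times_divide_eq_right mult.commute)
    then have "u x powr p = k x * (pnorm \<alpha> x powr ((?m - \<sigma>) * (p - 1)) * g x powr p)"
      using p k[of x] g[of x] by (simp add: u_def powr_mult powr_powr)
    then show ?thesis by (simp add: k_def indicator_def)
  qed
  have vq: "ennreal (v x powr q) = ennreal (coth_kernel \<alpha> \<beta> x y * pnorm \<alpha> x powr (\<sigma> - ?m)) * indicator orthant x" for x
  proof -
    have "v x powr q = k x * pnorm \<alpha> x powr (\<sigma> - ?m)"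
      using conj(1) k[of x] by (simp add: v_def powr_mult powr_powr)
    then show ?thesis by (simp add: k_def indicator_def)
  qed
  let ?S = "\<integral>\<^sup>+x. ennreal (coth_kernel \<alpha> \<beta> x y * g x) * indicator orthant x \<partial>lborel"
  have "?S = (\<integral>\<^sup>+x. ennreal (u x * v x) \<partial>lborel)"
    unfolding uv by (intro nn_integral_cong) (simp add: indicator_def)
  also have "\<dots> \<le> ennreal (A powr (1 / p) * B powr (1 / q))"
  proof (rule nn_integral_Holder[OF p pq])
    show "u \<in> borel_measurable lborel" "v \<in> borel_measurable lborel"
      unfolding u_def v_def by measurable
    show "u x \<ge> 0" "v x \<ge> 0" for x using g by (auto simp: u_def v_def)
    show "(\<integral>\<^sup>+x. ennreal (u x powr p) \<partial>lborel) = ennreal A"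
      unfolding up A(2)[symmetric] schur_integral_def ..
    show "(\<integral>\<^sup>+x. ennreal (v x powr q) \<partial>lborel) = ennreal B"
      unfolding vq B_def by (rule coth_kernel_integral_x[OF \<alpha> \<sigma> y])
  qed (use A B in auto)
  finally have S: "?S \<le> ennreal (A powr (1 / p) * B powr (1 / q))" .
  define I where "I = enn2real ?S"
  have I: "I \<ge> 0" "?S = ennreal I"
    using le_less_trans[OF S, of top] by (auto simp: I_def)
  have "I \<le> A powr (1 / p) * B powr (1 / q)"
    using S I by (simp add: ennreal_le_iff)
  then have "I powr p \<le> (A powr (1 / p) * B powr (1 / q)) powr p"
    using I p by (intro powr_mono2) auto
  also have "\<dots> = A * B powr (p - 1)"
    using A B p conj(2) by (simp add: powr_mult powr_powr)
  finally have "ennreal (I powr p) \<le> ennreal (B powr (p - 1)) * schur_integral \<alpha> \<beta> \<sigma> p g y"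
    using A by (simp add: ennreal_mult[symmetric] ennreal_leI mult.commute)
  with I that show ?thesis by (simp add: B_def)
qed

lemma coth_operator_schur_bound:
  fixes g :: "real ^ 'm \<Rightarrow> real"
  assumes \<alpha>: "\<alpha> > 0" and \<beta>: "\<beta> > 0" and \<sigma>: "\<sigma> > 1" and p: "p > 1" and pq: "1 / p + 1 / q = 1"
    and [measurable]: "g \<in> borel_measurable borel" and g: "\<And>x. g x \<ge> 0"
    and fin: "(\<integral>\<^sup>+x. ennreal (weight_Phi \<alpha> \<sigma> p x * g x powr p) * indicator orthant x \<partial>lborel) < \<infinity>"
  shows "(\<integral>\<^sup>+y. ennreal (pnorm \<beta> y powr (- p * \<sigma> - real CARD('n)) *
            enn2real (\<integral>\<^sup>+x. ennreal (coth_kernel \<alpha> \<beta> x y * g x) * indicator orthant x \<partial>lborel) powr p)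
            * indicator (orthant :: (real ^ 'n) set) y \<partial>lborel)
       \<le> ennreal ((sphere_const \<alpha> CARD('m) * coth_mellin \<sigma>) powr (p - 1) * (sphere_const \<beta> CARD('n) * coth_mellin \<sigma>))
          * (\<integral>\<^sup>+x. ennreal (weight_Phi \<alpha> \<sigma> p x * g x powr p) * indicator orthant x \<partial>lborel)"
proof -
  let ?n = "real CARD('n)" and ?m = "real CARD('m)"
  let ?O = "orthant :: (real ^ 'n) set"
  define S where "S y = (\<integral>\<^sup>+x. ennreal (coth_kernel \<alpha> \<beta> x y * g x) * indicator orthant x \<partial>lborel)" for y :: "real ^ 'n"
  define c where "c = sphere_const \<alpha> CARD('m) * coth_mellin \<sigma>"
  define d where "d = sphere_const \<beta> CARD('n) * coth_mellin \<sigma>"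
  have c: "c > 0" and d: "d > 0"
    using coth_mellin_pos[OF \<sigma>] sphere_const_pos[OF \<alpha>, of "CARD('m)"] sphere_const_pos[OF \<beta>, of "CARD('n)"]
    by (auto simp: c_def d_def)
  define h where "h x = pnorm \<alpha> x powr ((?m - \<sigma>) * (p - 1)) * g x powr p" for x
  have h: "h x \<ge> 0" for x by (simp add: h_def)
  have [measurable]: "h \<in> borel_measurable borel" unfolding h_def by measurable
  define H where "H x y = ennreal (h x) * indicator orthant x *
     (ennreal (coth_kernel \<alpha> \<beta> x y * pnorm \<beta> y powr (- \<sigma> - ?n)) * indicator ?O y)" for x y
  have Hm: "(\<lambda>(x, y). H x y) \<in> borel_measurable (lborel \<Otimes>\<^sub>M lborel)"
    unfolding H_def coth_kernel_def by measurable
  have "(\<integral>\<^sup>+y. ennreal (pnorm \<beta> y powr (- p * \<sigma> - ?n) * enn2real (S y) powr p) * indicator ?O y \<partial>lborel)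
     \<le> (\<integral>\<^sup>+y. ennreal (c powr (p - 1)) * (\<integral>\<^sup>+x. H x y \<partial>lborel) \<partial>lborel)"
  proof (intro nn_integral_mono)
    fix y :: "real ^ 'n"
    show "ennreal (pnorm \<beta> y powr (- p * \<sigma> - ?n) * enn2real (S y) powr p) * indicator ?O y
       \<le> ennreal (c powr (p - 1)) * (\<integral>\<^sup>+x. H x y \<partial>lborel)"
    proof (cases "y \<in> ?O")
      case y: True
      define s where "s = pnorm \<beta> y"
      have s: "s > 0" using y by (simp add: s_def pnorm_pos)
      obtain I where I: "I \<ge> 0" "S y = ennreal I"
        "ennreal (I powr p) \<le> ennreal ((c * s powr \<sigma>) powr (p - 1)) * schur_integral \<alpha> \<beta> \<sigma> p g y"
        using coth_operator_pointwise[OF \<alpha> \<sigma> p pq y _ g fin] unfolding S_def c_def s_def by auto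
      have "ennreal (s powr (- p * \<sigma> - ?n) * enn2real (S y) powr p)
          = ennreal (s powr (- p * \<sigma> - ?n)) * ennreal (I powr p)"
        using I by (simp add: ennreal_mult)
      also have "\<dots> \<le> ennreal (s powr (- p * \<sigma> - ?n)) * (ennreal ((c * s powr \<sigma>) powr (p - 1)) * schur_integral \<alpha> \<beta> \<sigma> p g y)"
        by (intro mult_left_mono I) auto
      also have "\<dots> = ennreal (s powr (- p * \<sigma> - ?n) * (c * s powr \<sigma>) powr (p - 1)) * schur_integral \<alpha> \<beta> \<sigma> p g y"
        by (simp add: ennreal_mult mult.assoc)
      also have "s powr (- p * \<sigma> - ?n) * (c * s powr \<sigma>) powr (p - 1) = c powr (p - 1) * s powr (- \<sigma> - ?n)"
        using c s by (simp add: powr_mult powr_powr powr_add[symmetric] algebra_simps)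
      also have "ennreal (c powr (p - 1) * s powr (- \<sigma> - ?n)) * schur_integral \<alpha> \<beta> \<sigma> p g y
          = ennreal (c powr (p - 1)) * (ennreal (s powr (- \<sigma> - ?n)) * schur_integral \<alpha> \<beta> \<sigma> p g y)"
        by (simp add: ennreal_mult mult.assoc)
      also have "ennreal (s powr (- \<sigma> - ?n)) * schur_integral \<alpha> \<beta> \<sigma> p g y = (\<integral>\<^sup>+x. H x y \<partial>lborel)"
      proof -
        have "ennreal (s powr (- \<sigma> - ?n)) * schur_integral \<alpha> \<beta> \<sigma> p g y =
          (\<integral>\<^sup>+x. ennreal (s powr (- \<sigma> - ?n)) * (ennreal (coth_kernel \<alpha> \<beta> x y * h x) * indicator orthant x) \<partial>lborel)"
          unfolding schur_integral_def h_def[symmetric]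
          by (rule nn_integral_cmult[symmetric]) measurable
        also have "\<dots> = (\<integral>\<^sup>+x. H x y \<partial>lborel)"
        proof (intro nn_integral_cong)
          fix x :: "real ^ 'm"
          show "ennreal (s powr (- \<sigma> - ?n)) * (ennreal (coth_kernel \<alpha> \<beta> x y * h x) * indicator orthant x) = H x y"
            using y h[of x] coth_kernel_nonneg[of x y \<alpha> \<beta>]
            by (cases "x \<in> orthant") (auto simp: H_def s_def ennreal_mult mult_ac)
        qed
        finally show ?thesis .
      qed
      finally show ?thesis using y by (simp add: s_def)
    qed simp
  qed
  also have "\<dots> = ennreal (c powr (p - 1)) * (\<integral>\<^sup>+y. \<integral>\<^sup>+x. H x y \<partial>lborel \<partial>lborel)"
    unfolding H_def coth_kernel_def by (intro nn_integral_cmult) measurable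
  also have "(\<integral>\<^sup>+y. \<integral>\<^sup>+x. H x y \<partial>lborel \<partial>lborel) = (\<integral>\<^sup>+x. \<integral>\<^sup>+y. H x y \<partial>lborel \<partial>lborel)"
    by (rule lborel_pair.Fubini'[OF Hm])
  also have "\<dots> = (\<integral>\<^sup>+x. ennreal d * (ennreal (weight_Phi \<alpha> \<sigma> p x * g x powr p) * indicator orthant x) \<partial>lborel)"
  proof (intro nn_integral_cong)
    fix x :: "real ^ 'm"
    show "(\<integral>\<^sup>+y. H x y \<partial>lborel) = ennreal d * (ennreal (weight_Phi \<alpha> \<sigma> p x * g x powr p) * indicator orthant x)"
    proof (cases "x \<in> orthant")
      case True
      define r where "r = pnorm \<alpha> x"
      have r: "r > 0" using True by (simp add: r_def pnorm_pos)
      have "(\<integral>\<^sup>+y. H x y \<partial>lborel) = ennreal (h x) * indicator orthant x *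
         (\<integral>\<^sup>+y. ennreal (coth_kernel \<alpha> \<beta> x y * pnorm \<beta> y powr (- \<sigma> - ?n)) * indicator ?O y \<partial>lborel)"
        unfolding H_def by (rule nn_integral_cmult) measurable
      also have "\<dots> = ennreal (h x) * ennreal (d * r powr (- \<sigma>))"
        using True by (simp add: coth_kernel_integral_y[OF \<beta> \<sigma> True] d_def r_def)
      also have "\<dots> = ennreal (d * (h x * r powr (- \<sigma>)))"
        using h[of x] d by (simp add: ennreal_mult[symmetric] mult_ac)
      also have "h x * r powr (- \<sigma>) = r powr ((?m - \<sigma>) * (p - 1) + - \<sigma>) * g x powr p"
        by (simp only: h_def r_def[symmetric] powr_add mult_ac)
      also have "(?m - \<sigma>) * (p - 1) + - \<sigma> = p * (?m - \<sigma>) - ?m" by (simp add: algebra_simps)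
      finally show ?thesis
        using True d by (simp add: weight_Phi_def r_def[symmetric] ennreal_mult)
    qed (simp add: H_def)
  qed
  also have "\<dots> = ennreal d * (\<integral>\<^sup>+x. ennreal (weight_Phi \<alpha> \<sigma> p x * g x powr p) * indicator orthant x \<partial>lborel)"
    unfolding weight_Phi_def by (rule nn_integral_cmult) measurable
  finally show ?thesis
    using c d by (simp add: S_def c_def[symmetric] d_def[symmetric] ennreal_mult mult.assoc)
qed

section \<open>Boundedness on the weighted spaces\<close>

lemma orthant_lebesgue [simp]: "(orthant :: (real ^ 's) set) \<inter> space lebesgue \<in> sets lebesgue"
  by simp

lemma borel_measurable_orthant_measure:
  fixes h :: "real ^ 's \<Rightarrow> real"
  assumes "h \<in> borel_measurable borel"
  shows "h \<in> borel_measurable orthant_measure"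
  using assms by (intro measurable_restrict_space1 measurable_completion) simp

lemma nn_integral_orthant_measure:
  fixes F :: "real ^ 's \<Rightarrow> ennreal"
  shows "(\<integral>\<^sup>+x. F x \<partial>orthant_measure) = (\<integral>\<^sup>+x. F x * indicator orthant x \<partial>lborel)"
  by (simp add: nn_integral_restrict_space nn_integral_completion)

text \<open>
  Elements of the weighted spaces are only Lebesgue measurable, while exchanging integrals
  requires joint Borel measurability; hence the passage to a Borel representative.
\<close>
lemma borel_representative:
  fixes f :: "real ^ 's \<Rightarrow> real"
  assumes "f \<in> borel_measurable orthant_measure"
  obtains g where "g \<in> borel_measurable borel" "AE x in lborel. x \<in> orthant \<longrightarrow> f x = g x"
proof -
  have "(\<lambda>x. indicator orthant x *\<^sub>R f x) \<in> borel_measurable lebesgue"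
    using assms by (simp add: borel_measurable_restrict_space_iff)
  from completion_ex_borel_measurable_real[OF this]
  obtain g where g: "g \<in> borel_measurable lborel" "AE x in lborel. indicator orthant x *\<^sub>R f x = g x"
    by blast
  from g(2) have "AE x in lborel. x \<in> orthant \<longrightarrow> f x = g x"
    by eventually_elim auto
  with g(1) that show ?thesis by auto
qed

lemma wLp_nn_integral:
  fixes f :: "real ^ 's \<Rightarrow> real"
  assumes "f \<in> wLp p w" "\<And>x. w x \<ge> 0"
  shows "(\<integral>\<^sup>+x. ennreal (w x * \<bar>f x\<bar> powr p) * indicator orthant x \<partial>lborel)
       = ennreal (LINT x|orthant_measure. w x * \<bar>f x\<bar> powr p)"
  using assms unfolding nn_integral_orthant_measure[symmetric]
  by (intro nn_integral_eq_integral) (auto simp: wLp_def)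

lemma wLp_iff:
  fixes f :: "real ^ 's \<Rightarrow> real"
  assumes "\<And>x. w x \<ge> 0" "w \<in> borel_measurable borel"
  shows "f \<in> wLp p w \<longleftrightarrow> f \<in> borel_measurable orthant_measure \<and>
    (\<integral>\<^sup>+x. ennreal (w x * \<bar>f x\<bar> powr p) * indicator orthant x \<partial>lborel) < \<infinity>"
proof -
  have "(\<lambda>x. w x * \<bar>f x\<bar> powr p) \<in> borel_measurable orthant_measure" if "f \<in> borel_measurable orthant_measure"
  proof -
    note that[measurable] borel_measurable_orthant_measure[OF assms(2), measurable]
    show ?thesis by measurable
  qed
  then show ?thesis
    using assms(1) by (auto simp: wLp_def integrable_iff_bounded nn_integral_orthant_measure)
qed

lemma Psi_weight_eq:
  fixes y :: "real ^ 'n"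
  assumes "p > 1" "1 / p + 1 / q = 1"
  shows "weight_Psi \<beta> \<sigma> q y powr (1 - p) = pnorm \<beta> y powr (- p * \<sigma> - real CARD('n))"
proof -
  have "(q * (real CARD('n) + \<sigma>) - real CARD('n)) * (1 - p)
      = (q * (1 - p)) * (real CARD('n) + \<sigma>) - real CARD('n) * (1 - p)"
    by (simp add: algebra_simps)
  also have "\<dots> = - p * \<sigma> - real CARD('n)"
    unfolding conjugate_exponent(3)[OF assms] by (simp add: algebra_simps)
  finally show ?thesis by (simp add: weight_Psi_def powr_powr)
qed

text \<open>The value of the operator norm, for dimensions \<open>m\<close> and \<open>n\<close>.\<close>
definition coth_norm :: "real \<Rightarrow> real \<Rightarrow> real \<Rightarrow> real \<Rightarrow> real \<Rightarrow> nat \<Rightarrow> nat \<Rightarrow> real" where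
  "coth_norm \<alpha> \<beta> \<sigma> p q m n =
     sphere_const \<beta> n powr (1 / p) * sphere_const \<alpha> m powr (1 / q) * coth_mellin \<sigma>"

lemma coth_norm_powr:
  assumes "\<alpha> > 0" "\<beta> > 0" "\<sigma> > 1" "p > 1" "1 / p + 1 / q = 1" "m > 0" "n > 0"
  shows "coth_norm \<alpha> \<beta> \<sigma> p q m n powr p
    = (sphere_const \<alpha> m * coth_mellin \<sigma>) powr (p - 1) * (sphere_const \<beta> n * coth_mellin \<sigma>)"
proof -
  have pos: "coth_mellin \<sigma> > 0" "sphere_const \<alpha> m > 0" "sphere_const \<beta> n > 0"
    using assms by (auto intro: coth_mellin_pos sphere_const_pos)
  have "coth_norm \<alpha> \<beta> \<sigma> p q m n powr p
      = sphere_const \<beta> n * sphere_const \<alpha> m powr (p - 1) * coth_mellin \<sigma> powr p"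
    using pos assms(4) conjugate_exponent(2)[OF assms(4,5)]
    by (simp add: coth_norm_def powr_mult powr_powr)
  also have "coth_mellin \<sigma> powr p = coth_mellin \<sigma> powr (p - 1) * coth_mellin \<sigma>"
    using pos by (simp add: powr_diff)
  finally show ?thesis using pos by (simp add: powr_mult mult_ac)
qed

text \<open>
  Replacing \<open>f\<close> by a Borel representative \<open>g\<close> does not change \<open>T f\<close> at any point, so \<open>T f\<close> is Borel
  measurable and the Schur bound for \<open>|g|\<close> applies.
\<close>
lemma coth_operator_bounded:
  fixes f :: "real ^ 'm \<Rightarrow> real" and \<alpha> \<beta> \<sigma> p q :: real
  defines "v \<equiv> \<lambda>y :: real ^ 'n. pnorm \<beta> y powr (- p * \<sigma> - real CARD('n))"
  assumes \<alpha>: "\<alpha> > 0" and \<beta>: "\<beta> > 0" and \<sigma>: "\<sigma> > 1" and p: "p > 1" and pq: "1 / p + 1 / q = 1"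
    and f: "f \<in> wLp p (weight_Phi \<alpha> \<sigma> p)"
  shows "\<And>y :: real ^ 'n. y \<in> orthant \<Longrightarrow> integrable orthant_measure (\<lambda>x. coth_kernel \<alpha> \<beta> x y * f x)"
    and "coth_operator \<alpha> \<beta> f \<in> wLp p v"
    and "wLp_norm p v (coth_operator \<alpha> \<beta> f)
      \<le> coth_norm \<alpha> \<beta> \<sigma> p q CARD('m) CARD('n) * wLp_norm p (weight_Phi \<alpha> \<sigma> p) f"
proof -
  have f_meas [measurable]: "f \<in> borel_measurable orthant_measure" using f by (simp add: wLp_def)
  obtain g where g [measurable]: "g \<in> borel_measurable borel"
    and fg: "AE x in lborel. x \<in> orthant \<longrightarrow> f x = g x"
    by (rule borel_representative[OF f_meas])
  let ?w = "weight_Phi \<alpha> \<sigma> p :: real ^ 'm \<Rightarrow> real"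
  have w0: "?w x \<ge> 0" for x by (simp add: weight_Phi_def)
  define L where "L = (LINT x|orthant_measure. ?w x * \<bar>f x\<bar> powr p)"
  have L0: "L \<ge> 0" unfolding L_def by (intro Bochner_Integration.integral_nonneg) (auto simp: w0)
  have gL: "(\<integral>\<^sup>+x. ennreal (?w x * \<bar>g x\<bar> powr p) * indicator orthant x \<partial>lborel) = ennreal L"
  proof -
    have "(\<integral>\<^sup>+x. ennreal (?w x * \<bar>g x\<bar> powr p) * indicator orthant x \<partial>lborel)
        = (\<integral>\<^sup>+x. ennreal (?w x * \<bar>f x\<bar> powr p) * indicator orthant x \<partial>lborel)"
    proof (rule nn_integral_cong_AE)
      show "AE x in lborel. ennreal (?w x * \<bar>g x\<bar> powr p) * indicator orthant x
          = ennreal (?w x * \<bar>f x\<bar> powr p) * indicator orthant x"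
        using fg by eventually_elim (auto simp: indicator_def)
    qed
    also have "\<dots> = ennreal L" unfolding L_def by (rule wLp_nn_integral[OF f w0])
    finally show ?thesis .
  qed
  have fin: "(\<integral>\<^sup>+x. ennreal (?w x * \<bar>g x\<bar> powr p) * indicator orthant x \<partial>lborel) < \<infinity>"
    by (simp add: gL)
  define F where "F y x = indicator orthant x *\<^sub>R (coth_kernel \<alpha> \<beta> x y * g x)" for x and y :: "real ^ 'n"
  have [measurable]: "F y \<in> borel_measurable borel" for y unfolding F_def by measurable
  define S where "S y = (\<integral>\<^sup>+x. ennreal (coth_kernel \<alpha> \<beta> x y * \<bar>g x\<bar>) * indicator orthant x \<partial>lborel)" for y :: "real ^ 'n"
  have S_fin: "S y < \<infinity>" if "y \<in> orthant" for y
    unfolding S_def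
    by (rule coth_operator_pointwise[OF \<alpha> \<sigma> p pq that _ _ fin, where \<beta>=\<beta>]) auto
  have FS: "(\<integral>\<^sup>+x. ennreal \<bar>F y x\<bar> \<partial>lborel) = S y" if "y \<in> orthant" for y
    unfolding S_def
  proof (intro nn_integral_cong)
    fix x :: "real ^ 'm"
    show "ennreal \<bar>F y x\<bar> = ennreal (coth_kernel \<alpha> \<beta> x y * \<bar>g x\<bar>) * indicator orthant x"
      using that coth_kernel_nonneg[of x y \<alpha> \<beta>] by (cases "x \<in> orthant") (auto simp: F_def abs_mult)
  qed
  have F_int: "integrable lborel (F y)" if "y \<in> orthant" for y
    using S_fin[OF that] by (intro integrableI_bounded) (auto simp: FS[OF that])
  have kf_meas: "(\<lambda>x. coth_kernel \<alpha> \<beta> x y * f x) \<in> borel_measurable orthant_measure" for y :: "real ^ 'n"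
    by (intro borel_measurable_times f_meas borel_measurable_orthant_measure) measurable
  then have kf_meas': "(\<lambda>x. indicator orthant x *\<^sub>R (coth_kernel \<alpha> \<beta> x y * f x)) \<in> borel_measurable lebesgue" for y :: "real ^ 'n"
    by (simp add: borel_measurable_restrict_space_iff)
  have F_meas': "F y \<in> borel_measurable lebesgue" for y
    by (intro measurable_completion) simp
  have AE_F: "AE x in lebesgue. F y x = indicator orthant x *\<^sub>R (coth_kernel \<alpha> \<beta> x y * f x)" for y
    by (rule AE_completion) (use fg in eventually_elim, auto simp: F_def indicator_def)
  show "integrable orthant_measure (\<lambda>x. coth_kernel \<alpha> \<beta> x y * f x)" if "y \<in> orthant" for y :: "real ^ 'n"
  proof -
    have "integrable lebesgue (F y)"
      using F_int[OF that] by (simp add: integrable_completion)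
    then have "integrable lebesgue (\<lambda>x. indicator orthant x *\<^sub>R (coth_kernel \<alpha> \<beta> x y * f x))"
      by (rule integrable_cong_AE_imp[OF _ kf_meas' AE_F])
    then show ?thesis by (simp add: integrable_restrict_space)
  qed
  have T_eq: "coth_operator \<alpha> \<beta> f y = (LINT x|lborel. F y x)" for y :: "real ^ 'n"
  proof -
    have "coth_operator \<alpha> \<beta> f y = (LINT x|lebesgue. indicator orthant x *\<^sub>R (coth_kernel \<alpha> \<beta> x y * f x))"
      unfolding coth_operator_def by (rule integral_restrict_space) simp
    also have "\<dots> = (LINT x|lebesgue. F y x)"
      by (rule integral_cong_AE[OF kf_meas' F_meas']) (use AE_F[of y] in eventually_elim, simp)
    also have "\<dots> = (LINT x|lborel. F y x)" by (rule integral_completion) simp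
    finally show ?thesis .
  qed
  have T_borel: "(coth_operator \<alpha> \<beta> f :: real ^ 'n \<Rightarrow> real) \<in> borel_measurable borel"
  proof -
    have "(\<lambda>y :: real ^ 'n. LINT x|lborel. F y x) \<in> borel_measurable borel"
      unfolding F_def coth_kernel_def by measurable
    then show ?thesis by (simp add: T_eq[abs_def] cong: measurable_cong)
  qed
  have T_le: "\<bar>coth_operator \<alpha> \<beta> f y\<bar> \<le> enn2real (S y)" if "y \<in> orthant" for y :: "real ^ 'n"
  proof -
    have "ennreal \<bar>coth_operator \<alpha> \<beta> f y\<bar> \<le> S y"
      using integral_norm_bound_ennreal[OF F_int[OF that]] by (simp add: T_eq FS[OF that])
    then have "enn2real (ennreal \<bar>coth_operator \<alpha> \<beta> f y\<bar>) \<le> enn2real (S y)"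
      using S_fin[OF that] by (intro enn2real_mono) auto
    then show ?thesis by simp
  qed
  have v0: "v y \<ge> 0" for y by (simp add: v_def)
  have [measurable]: "v \<in> borel_measurable borel" unfolding v_def by measurable
  let ?N = "coth_norm \<alpha> \<beta> \<sigma> p q CARD('m) CARD('n)"
  have main: "(\<integral>\<^sup>+y. ennreal (v y * \<bar>coth_operator \<alpha> \<beta> f y\<bar> powr p) * indicator orthant y \<partial>lborel)
      \<le> ennreal (?N powr p * L)"
  proof -
    have "(\<integral>\<^sup>+y. ennreal (v y * \<bar>coth_operator \<alpha> \<beta> f y\<bar> powr p) * indicator orthant y \<partial>lborel)
      \<le> (\<integral>\<^sup>+y. ennreal (v y * enn2real (S y) powr p) * indicator orthant y \<partial>lborel)"
    proof (intro nn_integral_mono)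
      fix y :: "real ^ 'n"
      show "ennreal (v y * \<bar>coth_operator \<alpha> \<beta> f y\<bar> powr p) * indicator orthant y
          \<le> ennreal (v y * enn2real (S y) powr p) * indicator orthant y"
        using T_le[of y] v0[of y] p
        by (cases "y \<in> orthant") (auto intro!: ennreal_leI mult_left_mono powr_mono2)
    qed
    also have "\<dots> \<le> ennreal ((sphere_const \<alpha> CARD('m) * coth_mellin \<sigma>) powr (p - 1) * (sphere_const \<beta> CARD('n) * coth_mellin \<sigma>))
          * (\<integral>\<^sup>+x. ennreal (?w x * \<bar>g x\<bar> powr p) * indicator orthant x \<partial>lborel)"
      unfolding v_def S_def
      by (rule coth_operator_schur_bound[OF \<alpha> \<beta> \<sigma> p pq _ _ fin]) auto
    also have "\<dots> = ennreal (?N powr p * L)"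
      using coth_norm_powr[OF \<alpha> \<beta> \<sigma> p pq, of "CARD('m)" "CARD('n)"] L0
      by (simp add: gL ennreal_mult''[OF L0])
    finally show ?thesis .
  qed
  show T_wLp: "coth_operator \<alpha> \<beta> f \<in> wLp p v"
    by (subst wLp_iff)
       (use v0 borel_measurable_orthant_measure[OF T_borel] le_less_trans[OF main, of top] in auto)
  have N0: "?N \<ge> 0"
    using coth_mellin_pos[OF \<sigma>] by (simp add: coth_norm_def)
  have "ennreal (LINT y|orthant_measure. v y * \<bar>coth_operator \<alpha> \<beta> f y\<bar> powr p) \<le> ennreal (?N powr p * L)"
    using main unfolding wLp_nn_integral[OF T_wLp v0] .
  then have "(LINT y|orthant_measure. v y * \<bar>coth_operator \<alpha> \<beta> f y\<bar> powr p) \<le> ?N powr p * L"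
    using L0 by (subst (asm) ennreal_le_iff) auto
  then have "wLp_norm p v (coth_operator \<alpha> \<beta> f) \<le> (?N powr p * L) powr (1 / p)"
    unfolding wLp_norm_def using p v0 by (intro powr_mono2 Bochner_Integration.integral_nonneg) auto
  also have "\<dots> = ?N * L powr (1 / p)"
    using N0 L0 p by (simp add: powr_mult powr_powr)
  finally show "wLp_norm p v (coth_operator \<alpha> \<beta> f) \<le> ?N * wLp_norm p ?w f"
    by (simp add: wLp_norm_def L_def)
qed

section \<open>The lower bound\<close>

lemma nn_integral_polar_annulus:
  assumes a: "a > 0" and cd: "c \<le> d"
  shows "(\<integral>\<^sup>+x. ennreal (pnorm a x powr (- real CARD('m)) * indicator {exp c..exp d} (pnorm a x))
            * indicator (orthant :: (real ^ 'm) set) x \<partial>lborel)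
    = ennreal (sphere_const a CARD('m) * (d - c))"
proof -
  have "(\<integral>\<^sup>+x. ennreal (pnorm a x powr (- real CARD('m)) * indicator {exp c..exp d} (pnorm a x))
            * indicator (orthant :: (real ^ 'm) set) x \<partial>lborel)
      = (\<integral>\<^sup>+x. indicator {exp c..exp d} (pnorm a x / 1) * ennreal (pnorm a x powr (0 - real CARD('m)))
            * indicator (orthant :: (real ^ 'm) set) x \<partial>lborel)"
    by (intro nn_integral_cong) (auto simp: indicator_def)
  also have "\<dots> = ennreal (sphere_const a CARD('m) * 1 powr 0) *
      (\<integral>\<^sup>+t. indicator {exp c..exp d} (exp t) * ennreal (exp (0 * t)) \<partial>lborel)"
    using a by (intro nn_integral_polar_scaled) auto
  also have "(\<integral>\<^sup>+t. indicator {exp c..exp d} (exp t) * ennreal (exp (0 * t)) \<partial>lborel)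
      = (\<integral>\<^sup>+t. indicator {c..d} t \<partial>lborel)"
    by (intro nn_integral_cong) (auto simp: indicator_def)
  also have "\<dots> = ennreal (d - c)" using cd by simp
  finally show ?thesis
    using cd sphere_const_pos[OF a, of "CARD('m)"] by (simp add: ennreal_mult[symmetric])
qed

text \<open>The part of the Mellin integral of \<open>coth u - 1\<close> with \<open>exp (- L) \<le> u \<le> exp L\<close>.\<close>
definition coth_mellin_trunc :: "real \<Rightarrow> real \<Rightarrow> real" where
  "coth_mellin_trunc \<sigma> L =
     enn2real (\<integral>\<^sup>+t. ennreal (coth (exp t) - 1) * ennreal (exp (\<sigma> * t)) * indicator {- L..L} t \<partial>lborel)"

lemma nn_integral_coth_trunc:
  assumes "\<sigma> > 1"
  shows "(\<integral>\<^sup>+t. ennreal (coth (exp t) - 1) * ennreal (exp (\<sigma> * t)) * indicator {- L..L} t \<partial>lborel)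
    = ennreal (coth_mellin_trunc \<sigma> L)"
proof -
  have "(\<integral>\<^sup>+t. ennreal (coth (exp t) - 1) * ennreal (exp (\<sigma> * t)) * indicator {- L..L} t \<partial>lborel)
    \<le> (\<integral>\<^sup>+t. ennreal (coth (exp t) - 1) * ennreal (exp (\<sigma> * t)) \<partial>lborel)"
    by (intro nn_integral_mono) (auto simp: indicator_def)
  also have "\<dots> < top" by (simp add: nn_integral_coth_minus_one[OF assms])
  finally show ?thesis by (simp add: coth_mellin_trunc_def)
qed

lemma coth_mellin_trunc_tendsto:
  assumes "\<sigma> > 1"
  shows "(\<lambda>n. coth_mellin_trunc \<sigma> (real n)) \<longlonglongrightarrow> coth_mellin \<sigma>"
proof -
  define h where "h t = ennreal (coth (exp t) - 1) * ennreal (exp (\<sigma> * t))" for t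
  have [measurable]: "h \<in> borel_measurable borel" unfolding h_def by measurable
  define A where "A n = {- real n..real n}" for n
  have "(\<lambda>n. emeasure (density lborel h) (A n)) \<longlonglongrightarrow> emeasure (density lborel h) (\<Union>n. A n)"
    by (rule Lim_emeasure_incseq) (auto simp: A_def incseq_def)
  moreover have "(\<Union>n. A n) = UNIV"
  proof -
    have "\<exists>n. t \<in> A n" for t
    proof -
      obtain n where "\<bar>t\<bar> \<le> real n" using real_arch_simple by blast
      then show ?thesis by (intro exI[of _ n]) (auto simp: A_def)
    qed
    then show ?thesis by auto
  qed
  moreover have "emeasure (density lborel h) (A n) = ennreal (coth_mellin_trunc \<sigma> (real n))" for n
    unfolding nn_integral_coth_trunc[OF assms, symmetric]
    by (subst emeasure_density) (auto simp: A_def h_def)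
  moreover have "emeasure (density lborel h) UNIV = ennreal (coth_mellin \<sigma>)"
    unfolding nn_integral_coth_minus_one[OF assms, symmetric]
    by (subst emeasure_density) (auto simp: h_def)
  ultimately have "(\<lambda>n. ennreal (coth_mellin_trunc \<sigma> (real n))) \<longlonglongrightarrow> ennreal (coth_mellin \<sigma>)" by simp
  then show ?thesis
    using coth_mellin_pos[OF assms]
    by (subst (asm) tendsto_ennreal_iff) (auto simp: coth_mellin_trunc_def)
qed

text \<open>
  The function \<open>g\<close> is \<open>|x|^(\<sigma>-m)\<close> on the annulus \<open>1 \<le> |x| \<le> exp R\<close>. If \<open>exp L \<le> |y| \<le> exp (R - L)\<close>,
  then all \<open>x\<close> with \<open>exp (- L) \<le> |x| / |y| \<le> exp L\<close> lie in this annulus, so the truncated Mellin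
  integral bounds the operator from below there.
\<close>
lemma coth_operator_test_function:
  fixes \<alpha> \<beta> \<sigma> p q L R :: real
  defines "v \<equiv> \<lambda>y :: real ^ 'n. pnorm \<beta> y powr (- p * \<sigma> - real CARD('n))"
    and "w \<equiv> weight_Phi \<alpha> \<sigma> p :: real ^ 'm \<Rightarrow> real"
  assumes \<alpha>: "\<alpha> > 0" and \<beta>: "\<beta> > 0" and \<sigma>: "\<sigma> > 1" and p: "p > 1" and pq: "1 / p + 1 / q = 1"
    and L: "L \<ge> 0" and R: "R > 2 * L"
  obtains g where "g \<in> wLp p w" "\<not> (AE x in orthant_measure. g x = 0)"
    "sphere_const \<beta> CARD('n) powr (1 / p) * sphere_const \<alpha> CARD('m) powr (1 / q)
        * coth_mellin_trunc \<sigma> L * (1 - 2 * L / R) powr (1 / p)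
      \<le> wLp_norm p v (coth_operator \<alpha> \<beta> g) / wLp_norm p w g"
proof -
  let ?m = "real CARD('m)" and ?n = "real CARD('n)"
  define Cm where "Cm = sphere_const \<alpha> CARD('m)"
  define Cn where "Cn = sphere_const \<beta> CARD('n)"
  define \<kappa> where "\<kappa> = coth_mellin_trunc \<sigma> L"
  have C: "Cm > 0" "Cn > 0" using \<alpha> \<beta> by (auto simp: Cm_def Cn_def sphere_const_pos)
  have \<kappa>: "\<kappa> \<ge> 0" by (simp add: \<kappa>_def coth_mellin_trunc_def)
  have R0: "R > 0" using L R by simp
  define g where "g x = pnorm \<alpha> x powr (\<sigma> - ?m) * indicator {exp 0..exp R} (pnorm \<alpha> x)" for x :: "real ^ 'm"
  have g0: "g x \<ge> 0" for x by (simp add: g_def)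
  have [measurable]: "g \<in> borel_measurable borel" unfolding g_def by measurable
  have w0: "w x \<ge> 0" for x by (simp add: w_def weight_Phi_def)
  have v0: "v y \<ge> 0" for y by (simp add: v_def)
  have w_meas: "w \<in> borel_measurable borel" unfolding w_def weight_Phi_def by measurable
  have gnorm: "(\<integral>\<^sup>+x. ennreal (w x * \<bar>g x\<bar> powr p) * indicator orthant x \<partial>lborel) = ennreal (Cm * R)"
  proof -
    have "(\<integral>\<^sup>+x. ennreal (w x * \<bar>g x\<bar> powr p) * indicator orthant x \<partial>lborel)
        = (\<integral>\<^sup>+x. ennreal (pnorm \<alpha> x powr (- ?m) * indicator {exp 0..exp R} (pnorm \<alpha> x))
            * indicator (orthant :: (real ^ 'm) set) x \<partial>lborel)"
    proof (intro nn_integral_cong)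
      fix x :: "real ^ 'm"
      have "w x * \<bar>g x\<bar> powr p = pnorm \<alpha> x powr (- ?m) * indicator {exp 0..exp R} (pnorm \<alpha> x)"
        using p g0[of x] by (simp add: w_def weight_Phi_def g_def powr_powr powr_add[symmetric] indicator_def algebra_simps)
      then show "ennreal (w x * \<bar>g x\<bar> powr p) * indicator orthant x
          = ennreal (pnorm \<alpha> x powr (- ?m) * indicator {exp 0..exp R} (pnorm \<alpha> x)) * indicator orthant x"
        by simp
    qed
    also have "\<dots> = ennreal (Cm * (R - 0))"
      unfolding Cm_def using \<alpha> R0 by (intro nn_integral_polar_annulus) auto
    finally show ?thesis by simp
  qed
  have g_wLp: "g \<in> wLp p w"
    using gnorm by (subst wLp_iff) (auto simp: w0 w_meas intro!: borel_measurable_orthant_measure)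
  have Lg: "(LINT x|orthant_measure. w x * \<bar>g x\<bar> powr p) = Cm * R"
    using gnorm wLp_nn_integral[OF g_wLp w0] C R0
    by (simp add: Bochner_Integration.integral_nonneg w0)
  have g_nz: "\<not> (AE x in orthant_measure. g x = 0)"
  proof
    assume "AE x in orthant_measure. g x = 0"
    then have "AE x in orthant_measure. ennreal (w x * \<bar>g x\<bar> powr p) = 0"
      by eventually_elim simp
    then have "(\<integral>\<^sup>+x. ennreal (w x * \<bar>g x\<bar> powr p) \<partial>orthant_measure) = (\<integral>\<^sup>+x. 0 \<partial>(orthant_measure :: (real ^ 'm) measure))"
      by (rule nn_integral_cong_AE)
    then have "ennreal (Cm * R) = 0" by (simp add: nn_integral_orthant_measure gnorm)
    with C R0 show False by simp
  qed
  note bounded = coth_operator_bounded[OF \<alpha> \<beta> \<sigma> p pq g_wLp[unfolded w_def], where 'n='n, folded v_def]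
  have T_lower: "Cm * pnorm \<beta> y powr \<sigma> * \<kappa> \<le> coth_operator \<alpha> \<beta> g y"
    if y: "y \<in> orthant" and s: "exp L \<le> pnorm \<beta> y" "pnorm \<beta> y \<le> exp (R - L)" for y :: "real ^ 'n"
  proof -
    let ?s = "pnorm \<beta> y"
    have s0: "?s > 0" by (rule pnorm_pos[OF y])
    define G where "G u = ennreal (coth u - 1) * indicator {exp (- L)..exp L} u" for u
    have [measurable]: "G \<in> borel_measurable borel" unfolding G_def by measurable
    have "ennreal (Cm * ?s powr \<sigma> * \<kappa>)
        = ennreal (Cm * ?s powr \<sigma>) * (\<integral>\<^sup>+t. ennreal (coth (exp t) - 1) * ennreal (exp (\<sigma> * t)) * indicator {- L..L} t \<partial>lborel)"
      using C \<kappa> by (simp add: nn_integral_coth_trunc[OF \<sigma>] \<kappa>_def[symmetric] ennreal_mult)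
    also have "(\<integral>\<^sup>+t. ennreal (coth (exp t) - 1) * ennreal (exp (\<sigma> * t)) * indicator {- L..L} t \<partial>lborel)
        = (\<integral>\<^sup>+t. G (exp t) * ennreal (exp (\<sigma> * t)) \<partial>lborel)"
      by (intro nn_integral_cong) (auto simp: G_def indicator_def)
    also have "ennreal (Cm * ?s powr \<sigma>) * \<dots> =
       (\<integral>\<^sup>+x. G (pnorm \<alpha> x / ?s) * ennreal (pnorm \<alpha> x powr (\<sigma> - ?m)) * indicator (orthant :: (real ^ 'm) set) x \<partial>lborel)"
      unfolding Cm_def using \<alpha> s0 by (intro nn_integral_polar_scaled[symmetric]) auto
    also have "\<dots> \<le> (\<integral>\<^sup>+x. ennreal (coth_kernel \<alpha> \<beta> x y * g x) * indicator orthant x \<partial>lborel)"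
    proof (intro nn_integral_mono)
      fix x :: "real ^ 'm"
      show "G (pnorm \<alpha> x / ?s) * ennreal (pnorm \<alpha> x powr (\<sigma> - ?m)) * indicator orthant x
          \<le> ennreal (coth_kernel \<alpha> \<beta> x y * g x) * indicator orthant x"
      proof (cases "x \<in> orthant \<and> pnorm \<alpha> x / ?s \<in> {exp (- L)..exp L}")
        case True
        then have x: "x \<in> orthant" and le: "exp (- L) * ?s \<le> pnorm \<alpha> x" "pnorm \<alpha> x \<le> exp L * ?s"
          using s0 by (auto simp: field_simps)
        have "exp (- L) * exp L \<le> exp (- L) * ?s" using s by (intro mult_left_mono) auto
        then have "1 \<le> pnorm \<alpha> x" using le by (simp add: exp_add[symmetric])
        moreover have "exp L * ?s \<le> exp L * exp (R - L)" using s by (intro mult_left_mono) auto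
        then have "pnorm \<alpha> x \<le> exp R" using le by (simp add: exp_add[symmetric])
        ultimately have "g x = pnorm \<alpha> x powr (\<sigma> - ?m)" by (simp add: g_def)
        then show ?thesis
          using True coth_kernel_nonneg[OF x y, of \<alpha> \<beta>]
          by (simp add: G_def coth_kernel_def ennreal_mult)
      qed (auto simp: G_def indicator_def)
    qed
    also have "\<dots> = (\<integral>\<^sup>+x. ennreal (coth_kernel \<alpha> \<beta> x y * g x) \<partial>orthant_measure)"
      by (simp add: nn_integral_orthant_measure)
    also have "\<dots> = ennreal (coth_operator \<alpha> \<beta> g y)"
      unfolding coth_operator_def
    proof (rule nn_integral_eq_integral[OF bounded(1)[OF y]])
      show "AE x in orthant_measure. 0 \<le> coth_kernel \<alpha> \<beta> x y * g x"
        by (rule AE_I2) (auto simp: space_restrict_space g0 coth_kernel_nonneg y)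
    qed
    finally have "ennreal (Cm * ?s powr \<sigma> * \<kappa>) \<le> ennreal (coth_operator \<alpha> \<beta> g y)" .
    moreover have "0 \<le> coth_operator \<alpha> \<beta> g y"
      unfolding coth_operator_def
      by (intro Bochner_Integration.integral_nonneg_AE AE_I2)
         (auto simp: space_restrict_space g0 coth_kernel_nonneg y)
    ultimately show ?thesis by (simp add: ennreal_le_iff)
  qed
  have "ennreal ((Cm * \<kappa>) powr p * (Cn * (R - L - L)))
      = ennreal ((Cm * \<kappa>) powr p) * ennreal (Cn * (R - L - L))"
    using C R by (simp add: ennreal_mult)
  also have "ennreal (Cn * (R - L - L)) =
      (\<integral>\<^sup>+y. ennreal (pnorm \<beta> y powr (- ?n) * indicator {exp L..exp (R - L)} (pnorm \<beta> y))
            * indicator (orthant :: (real ^ 'n) set) y \<partial>lborel)"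
    unfolding Cn_def using \<beta> R by (intro nn_integral_polar_annulus[symmetric]) auto
  also have "ennreal ((Cm * \<kappa>) powr p) * \<dots> =
      (\<integral>\<^sup>+y. ennreal ((Cm * \<kappa>) powr p) * (ennreal (pnorm \<beta> y powr (- ?n) * indicator {exp L..exp (R - L)} (pnorm \<beta> y))
            * indicator (orthant :: (real ^ 'n) set) y) \<partial>lborel)"
    by (rule nn_integral_cmult[symmetric]) measurable
  also have "\<dots> \<le> (\<integral>\<^sup>+y. ennreal (v y * \<bar>coth_operator \<alpha> \<beta> g y\<bar> powr p) * indicator (orthant :: (real ^ 'n) set) y \<partial>lborel)"
  proof (intro nn_integral_mono)
    fix y :: "real ^ 'n"
    show "ennreal ((Cm * \<kappa>) powr p) * (ennreal (pnorm \<beta> y powr (- ?n) * indicator {exp L..exp (R - L)} (pnorm \<beta> y))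
            * indicator orthant y)
        \<le> ennreal (v y * \<bar>coth_operator \<alpha> \<beta> g y\<bar> powr p) * indicator orthant y"
    proof (cases "y \<in> orthant \<and> pnorm \<beta> y \<in> {exp L..exp (R - L)}")
      case True
      define s where "s = pnorm \<beta> y"
      have s: "s > 0" using True by (simp add: s_def pnorm_pos)
      have "(Cm * \<kappa>) powr p * s powr (- ?n) = v y * (Cm * s powr \<sigma> * \<kappa>) powr p"
        using C \<kappa> s by (simp add: v_def s_def[symmetric] powr_mult powr_powr powr_diff powr_minus field_simps)
      also have "\<dots> \<le> v y * \<bar>coth_operator \<alpha> \<beta> g y\<bar> powr p"
        using T_lower[of y] True C \<kappa> p v0[of y]
        by (intro mult_left_mono powr_mono2) (auto simp: s_def)
      finally show ?thesis
        using True by (simp add: s_def ennreal_mult'[symmetric] ennreal_leI)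
    qed (auto simp: indicator_def)
  qed
  also have "\<dots> = ennreal (LINT y|orthant_measure. v y * \<bar>coth_operator \<alpha> \<beta> g y\<bar> powr p)"
    by (rule wLp_nn_integral[OF bounded(2) v0])
  finally have "(Cm * \<kappa>) powr p * (Cn * (R - L - L)) \<le> (LINT y|orthant_measure. v y * \<bar>coth_operator \<alpha> \<beta> g y\<bar> powr p)"
    by (subst (asm) ennreal_le_iff) (auto intro!: Bochner_Integration.integral_nonneg simp: v0)
  then have "((Cm * \<kappa>) powr p * (Cn * (R - L - L))) powr (1 / p) \<le> wLp_norm p v (coth_operator \<alpha> \<beta> g)"
    unfolding wLp_norm_def using C R p by (intro powr_mono2) auto
  moreover have "wLp_norm p w g = (Cm * R) powr (1 / p)"
    by (simp add: wLp_norm_def Lg)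
  ultimately have "((Cm * \<kappa>) powr p * (Cn * (R - L - L))) powr (1 / p) / (Cm * R) powr (1 / p)
      \<le> wLp_norm p v (coth_operator \<alpha> \<beta> g) / wLp_norm p w g"
    by (simp add: divide_right_mono)
  also have "((Cm * \<kappa>) powr p * (Cn * (R - L - L))) powr (1 / p) / (Cm * R) powr (1 / p)
      = Cn powr (1 / p) * Cm powr (1 / q) * \<kappa> * (1 - 2 * L / R) powr (1 / p)"
  proof -
    define K where "K = R - L - L"
    have "1 - 2 * L / R = K / R" using R0 by (simp add: K_def field_simps)
    moreover have "1 / q = 1 - 1 / p" using pq by simp
    moreover have "K > 0" using R by (simp add: K_def)
    ultimately show ?thesis
      unfolding K_def[symmetric]
      using C \<kappa> R0 p by (simp add: powr_mult powr_divide powr_powr powr_diff)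
  qed
  finally show ?thesis
    using that[OF g_wLp g_nz] by (simp add: Cn_def Cm_def \<kappa>_def)
qed

lemma coth_operator_lower_bound:
  fixes \<alpha> \<beta> \<sigma> p q M :: real
  defines "v \<equiv> \<lambda>y :: real ^ 'n. pnorm \<beta> y powr (- p * \<sigma> - real CARD('n))"
    and "w \<equiv> weight_Phi \<alpha> \<sigma> p :: real ^ 'm \<Rightarrow> real"
  assumes \<alpha>: "\<alpha> > 0" and \<beta>: "\<beta> > 0" and \<sigma>: "\<sigma> > 1" and p: "p > 1" and pq: "1 / p + 1 / q = 1"
    and M: "\<And>g. g \<in> wLp p w \<Longrightarrow> \<not> (AE x in orthant_measure. g x = 0) \<Longrightarrow>
      wLp_norm p v (coth_operator \<alpha> \<beta> g) / wLp_norm p w g \<le> M"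
  shows "coth_norm \<alpha> \<beta> \<sigma> p q CARD('m) CARD('n) \<le> M"
proof -
  define D where "D = sphere_const \<beta> CARD('n) powr (1 / p) * sphere_const \<alpha> CARD('m) powr (1 / q)"
  have trunc: "D * coth_mellin_trunc \<sigma> L \<le> M" if L: "L \<ge> 0" for L
  proof (rule tendsto_upperbound)
    have "((\<lambda>R. (1 - 2 * L / R)) \<longlongrightarrow> 1) at_top" by real_asymp
    then have "((\<lambda>R. (1 - 2 * L / R) powr (1 / p)) \<longlongrightarrow> 1 powr (1 / p)) at_top"
      by (intro tendsto_powr) auto
    from tendsto_mult[OF tendsto_const this, of "D * coth_mellin_trunc \<sigma> L"]
    show "((\<lambda>R. D * coth_mellin_trunc \<sigma> L * (1 - 2 * L / R) powr (1 / p)) \<longlongrightarrow> D * coth_mellin_trunc \<sigma> L) at_top"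
      by simp
    show "\<forall>\<^sub>F R in at_top. D * coth_mellin_trunc \<sigma> L * (1 - 2 * L / R) powr (1 / p) \<le> M"
      using eventually_gt_at_top[of "2 * L"]
    proof eventually_elim
      case (elim R)
      show ?case
        by (rule coth_operator_test_function[OF \<alpha> \<beta> \<sigma> p pq L elim, where 'n='n and 'm='m, folded v_def w_def D_def])
           (use M order_trans in blast)
    qed
  qed simp
  have "(\<lambda>n. D * coth_mellin_trunc \<sigma> (real n)) \<longlonglongrightarrow> D * coth_mellin \<sigma>"
    by (intro tendsto_intros coth_mellin_trunc_tendsto \<sigma>)
  then have "D * coth_mellin \<sigma> \<le> M"
    by (rule LIMSEQ_le_const2) (use trunc in auto)
  then show ?thesis by (simp add: coth_norm_def D_def)
qed

section \<open>The norm of the operator\<close>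

theorem mainTheorem3:
  fixes \<alpha> \<beta> \<sigma> p q :: real
    and \<Phi> :: "real ^ 'm \<Rightarrow> real"
    and \<Psi> :: "real ^ 'n \<Rightarrow> real"
    and T :: "(real ^ 'm \<Rightarrow> real) \<Rightarrow> (real ^ 'n \<Rightarrow> real)"
  assumes "\<alpha> > 0" and "\<beta> > 0" and "\<sigma> > 1" and "p > 1" and "1 / p + 1 / q = 1"
    and "\<Phi> = weight_Phi \<alpha> \<sigma> p"
    and "\<Psi> = weight_Psi \<beta> \<sigma> q"
    and "T = coth_operator \<alpha> \<beta>"
  shows "(\<forall>f\<in>wLp p \<Phi>. \<forall>y\<in>(orthant :: (real ^ 'n) set).
            integrable orthant_measure (\<lambda>x. coth_kernel \<alpha> \<beta> x y * f x)) \<and>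
         bounded_wLp_operator p \<Phi> (\<lambda>y. \<Psi> y powr (1 - p)) T \<and>
         wLp_opnorm p \<Phi> (\<lambda>y. \<Psi> y powr (1 - p)) T =
           (Gamma (1 / \<beta>) ^ CARD('n) /
              (\<beta> ^ (CARD('n) - 1) * Gamma (real CARD('n) / \<beta>))) powr (1 / p) *
           (Gamma (1 / \<alpha>) ^ CARD('m) /
              (\<alpha> ^ (CARD('m) - 1) * Gamma (real CARD('m) / \<alpha>))) powr (1 / q) *
           (Gamma \<sigma> / 2 powr (\<sigma> - 1)) * zeta \<sigma>"
proof -
  let ?N = "coth_norm \<alpha> \<beta> \<sigma> p q CARD('m) CARD('n)"
  define v where "v = (\<lambda>y :: real ^ 'n. pnorm \<beta> y powr (- p * \<sigma> - real CARD('n)))"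
  have \<Psi>v: "(\<lambda>y. \<Psi> y powr (1 - p)) = v"
    using Psi_weight_eq[OF assms(4,5)] by (auto simp: v_def assms(7))
  note op = coth_operator_bounded[OF assms(1-5), where 'm='m and 'n='n, folded assms(6) assms(8) v_def]
  have bounded: "bounded_wLp_operator p \<Phi> v T"
    unfolding bounded_wLp_operator_def
  proof (intro conjI ballI impI allI)
    show "T f \<in> wLp p v" if "f \<in> wLp p \<Phi>" for f by (rule op(2)[OF that])
    show "AE y in orthant_measure. T f y = T g y"
      if "f \<in> wLp p \<Phi>" "g \<in> wLp p \<Phi>" and fg: "AE x in orthant_measure. f x = g x" for f g
    proof (rule AE_I2)
      fix y :: "real ^ 'n" assume "y \<in> space orthant_measure"
      then have y: "y \<in> orthant" by (simp add: space_restrict_space)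
      show "T f y = T g y"
        unfolding assms(8) coth_operator_def
        by (rule integral_cong_AE)
           (use op(1)[OF that(1) y] op(1)[OF that(2) y] fg in auto)
    qed
    show "AE y in orthant_measure. T (\<lambda>x. f x + g x) y = T f y + T g y"
      if "f \<in> wLp p \<Phi>" "g \<in> wLp p \<Phi>" for f g
    proof (rule AE_I2)
      fix y :: "real ^ 'n" assume "y \<in> space orthant_measure"
      then have y: "y \<in> orthant" by (simp add: space_restrict_space)
      show "T (\<lambda>x. f x + g x) y = T f y + T g y"
        unfolding assms(8) coth_operator_def
        by (simp add: distrib_left Bochner_Integration.integral_add op(1)[OF that(1) y] op(1)[OF that(2) y])
    qed
    show "AE y in orthant_measure. T (\<lambda>x. c * f x) y = c * T f y" for c f
      unfolding assms(8) coth_operator_def by (simp add: mult.left_commute[of _ c])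
    show "\<exists>C. \<forall>f\<in>wLp p \<Phi>. wLp_norm p v (T f) \<le> C * wLp_norm p \<Phi> f"
      using op(3) by blast
  qed
  have N0: "?N \<ge> 0" using coth_mellin_pos[OF assms(3)] by (simp add: coth_norm_def)
  have upper: "wLp_norm p v (T f) / wLp_norm p \<Phi> f \<le> ?N" if "f \<in> wLp p \<Phi>" for f
  proof -
    have "wLp_norm p \<Phi> f \<ge> 0" by (simp add: wLp_norm_def)
    \<comment> \<open>A vanishing denominator makes the quotient \<open>0\<close>.\<close>
    then show ?thesis
      using op(3)[OF that] N0 by (cases "wLp_norm p \<Phi> f = 0") (auto simp: divide_le_eq)
  qed
  have "wLp_opnorm p \<Phi> v T = ?N"
    unfolding wLp_opnorm_def
  proof (rule cSup_eq_non_empty)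
    show "(\<lambda>f. wLp_norm p v (T f) / wLp_norm p \<Phi> f) ` {f \<in> wLp p \<Phi>. \<not> (AE x in orthant_measure. f x = 0)} \<noteq> {}"
      \<comment> \<open>Any admissible pair of parameters gives a nonzero element; here \<open>L = 0\<close> and \<open>R = 1\<close>.\<close>
      by (rule coth_operator_test_function[OF assms(1-5), of 0 1, where 'm='m and 'n='n, folded assms(6)]) auto
    show "?N \<le> M"
      if "\<And>r. r \<in> (\<lambda>f. wLp_norm p v (T f) / wLp_norm p \<Phi> f) ` {f \<in> wLp p \<Phi>. \<not> (AE x in orthant_measure. f x = 0)} \<Longrightarrow> r \<le> M"
      for M
      by (rule coth_operator_lower_bound[OF assms(1-5), where 'm='m and 'n='n, folded assms(6) assms(8) v_def]) (use that in auto)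
  qed (use upper in auto)
  then show ?thesis
    using op(1) bounded unfolding \<Psi>v
    by (simp add: coth_norm_def sphere_const_def coth_mellin_def)
qed

end
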